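(* Let $P=(\mathcal{A},\mathcal{C})$ be a measuring left $\alpha$-pairing over $R$. 1. If $M\in\mathrm{Rat}^{\mathcal{C}}(\mathcal{M}_{\mathcal{A}})$, then for every finite subset $\{m_1,\dots,m_k\}\subset M$ there exists some $N\in\mathrm{Rat}^{\mathcal{C}}(\mathcal{M}_{\mathcal{A}})$ such that $N\subset M$ is an $\mathcal{A}$-submodule containing $\{m_1,\dots,m_k\}$ and $N$ is finitely generated as a right $R$-module. 2. Every finite subset of $\mathcal{C}$ is contained in a right $\mathcal{C}$-coideal which is finitely generated as a right $R$-module.
   Context: $R$ is an associative (not necessarily commutative) ring with $1\neq 0$. An $R$-ring is an $R$-bimodule $\mathcal{A}$ with an associative $R$-bilinear multiplication $\mathcal{A}\otimes_R\mathcal{A}\to\mathcal{A}$, with unity (given by an $R$-bilinear unit map $R\to\mathcal{A}$); morphisms are $R$-bilinear, multiplicative and preserve unities. An $R$-coring is an $R$-bimodule $\mathcal{C}$ with $R$-bilinear coassociative $\Delta(c)=\sum c_1\otimes c_2\in\mathcal{C}\otimes_R\mathcal{C}$ and counit $\varepsilon_{\mathcal{C}}:\mathcal{C}\to R$. ${}^{*}\mathcal{C}:=\mathrm{Hom}_{R-}(\mathcal{C},R)$ (left $R$-linear maps) is an $R$-ring with $(rf)(c)=f(cr)$, $(fr)(c)=f(c)r$, $(f\star g)(c)=\sum g(c_1f(c_2))$, unity $\varepsilon_{\mathcal{C}}$. A measuring left $\alpha$-pairing $P=(\mathcal{A},\mathcal{C})$ consists of an $R$-ring $\mathcal{A}$,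 an $R$-coring $\mathcal{C}$ and a morphism of $R$-rings $\kappa_P:\mathcal{A}\to{}^{*}\mathcal{C}$ (write $\langle a,c\rangle=\kappa_P(a)(c)$) such that for every right $R$-module $M$ the map $\alpha_M^P:M\otimes_R\mathcal{C}\to\mathrm{Hom}_{-R}(\mathcal{A},M)$, $m\otimes c\mapsto[a\mapsto m\langle a,c\rangle]$, is injective. $\mathrm{Rat}^{\mathcal{C}}(\mathcal{M}_{\mathcal{A}})$ is the category of unital right $\mathcal{A}$-modules $M$ that are $\mathcal{C}$-rational: for every $m\in M$ there is $\sum m_i\otimes c_i\in M\otimes_R\mathcal{C}$ with $ma=\sum m_i\langle a,c_i\rangle$ for all $a\in\mathcal{A}$. A right $R$-submodule $K\subset\mathcal{C}$ is a right $\mathcal{C}$-coideal if $\Delta(K)\subseteq\mathrm{Im}(K\otimes_R\mathcal{C}\to\mathcal{C}\otimes_R\mathcal{C})$. *)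

theory Defs
  imports "HOL-Algebra.Algebra"
begin

section \<open>Modules and bimodules over a noncommutative ring\<close>

text \<open>
  The library's \<^locale>\<open>module\<close> is restricted to commutative rings and left scalars.  As there, a
  module record extends the ring record; the multiplicative fields are meaningless for modules and
  are used only for the ring structure of an \<open>R\<close>-ring.
\<close>

record ('r, 'm) rmodule = "'m ring" +
  rsmult :: "['m, 'r] \<Rightarrow> 'm" (infixl \<open>\<triangleleft>\<index>\<close> 70)

record ('r, 'm) bimodule = "('r, 'm) rmodule" +
  lsmult :: "['r, 'm] \<Rightarrow> 'm" (infixr \<open>\<triangleright>\<index>\<close> 70)

locale right_module = R?: ring R + M?: abelian_group M
  for R :: "('r, 'z) ring_scheme" (structure) and M :: "('r, 'm, 'w) rmodule_scheme" (structure) +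
  assumes rsmult_closed [simp, intro]:
      "\<lbrakk>x \<in> carrier M; r \<in> carrier R\<rbrakk> \<Longrightarrow> x \<triangleleft>\<^bsub>M\<^esub> r \<in> carrier M"
    and rsmult_l_distr:
      "\<lbrakk>x \<in> carrier M; y \<in> carrier M; r \<in> carrier R\<rbrakk> \<Longrightarrow>
        (x \<oplus>\<^bsub>M\<^esub> y) \<triangleleft>\<^bsub>M\<^esub> r = x \<triangleleft>\<^bsub>M\<^esub> r \<oplus>\<^bsub>M\<^esub> y \<triangleleft>\<^bsub>M\<^esub> r"
    and rsmult_r_distr:
      "\<lbrakk>x \<in> carrier M; r \<in> carrier R; s \<in> carrier R\<rbrakk> \<Longrightarrow>
        x \<triangleleft>\<^bsub>M\<^esub> (r \<oplus>\<^bsub>R\<^esub> s) = x \<triangleleft>\<^bsub>M\<^esub> r \<oplus>\<^bsub>M\<^esub> x \<triangleleft>\<^bsub>M\<^esub> s"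
    and rsmult_assoc:
      "\<lbrakk>x \<in> carrier M; r \<in> carrier R; s \<in> carrier R\<rbrakk> \<Longrightarrow>
        x \<triangleleft>\<^bsub>M\<^esub> (r \<otimes>\<^bsub>R\<^esub> s) = (x \<triangleleft>\<^bsub>M\<^esub> r) \<triangleleft>\<^bsub>M\<^esub> s"
    and rsmult_one [simp]:
      "x \<in> carrier M \<Longrightarrow> x \<triangleleft>\<^bsub>M\<^esub> \<one>\<^bsub>R\<^esub> = x"

locale left_module = R?: ring R + M?: abelian_group M
  for R :: "('r, 'z) ring_scheme" (structure) and M :: "('r, 'm, 'w) bimodule_scheme" (structure) +
  assumes lsmult_closed [simp, intro]:
      "\<lbrakk>r \<in> carrier R; x \<in> carrier M\<rbrakk> \<Longrightarrow> r \<triangleright>\<^bsub>M\<^esub> x \<in> carrier M"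
    and lsmult_r_distr:
      "\<lbrakk>r \<in> carrier R; x \<in> carrier M; y \<in> carrier M\<rbrakk> \<Longrightarrow>
        r \<triangleright>\<^bsub>M\<^esub> (x \<oplus>\<^bsub>M\<^esub> y) = (r \<triangleright>\<^bsub>M\<^esub> x) \<oplus>\<^bsub>M\<^esub> (r \<triangleright>\<^bsub>M\<^esub> y)"
    and lsmult_l_distr:
      "\<lbrakk>r \<in> carrier R; s \<in> carrier R; x \<in> carrier M\<rbrakk> \<Longrightarrow>
        (r \<oplus>\<^bsub>R\<^esub> s) \<triangleright>\<^bsub>M\<^esub> x = (r \<triangleright>\<^bsub>M\<^esub> x) \<oplus>\<^bsub>M\<^esub> (s \<triangleright>\<^bsub>M\<^esub> x)"
    and lsmult_assoc:
      "\<lbrakk>r \<in> carrier R; s \<in> carrier R; x \<in> carrier M\<rbrakk> \<Longrightarrow>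
        (r \<otimes>\<^bsub>R\<^esub> s) \<triangleright>\<^bsub>M\<^esub> x = r \<triangleright>\<^bsub>M\<^esub> (s \<triangleright>\<^bsub>M\<^esub> x)"
    and lsmult_one [simp]:
      "x \<in> carrier M \<Longrightarrow> \<one>\<^bsub>R\<^esub> \<triangleright>\<^bsub>M\<^esub> x = x"

locale bimodule = right_module R M + left_module R M
  for R :: "('r, 'z) ring_scheme" (structure) and M :: "('r, 'm, 'w) bimodule_scheme" (structure) +
  assumes lsmult_rsmult:
      "\<lbrakk>r \<in> carrier R; x \<in> carrier M; s \<in> carrier R\<rbrakk> \<Longrightarrow>
        (r \<triangleright>\<^bsub>M\<^esub> x) \<triangleleft>\<^bsub>M\<^esub> s = r \<triangleright>\<^bsub>M\<^esub> (x \<triangleleft>\<^bsub>M\<^esub> s)"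

locale right_submodule = subgroup H "add_monoid M"
  for H and R :: "('r, 'z) ring_scheme" and M :: "('r, 'm, 'w) rmodule_scheme" (structure) +
  assumes rsmult_closed [simp, intro]:
      "\<lbrakk>x \<in> H; r \<in> carrier R\<rbrakk> \<Longrightarrow> x \<triangleleft>\<^bsub>M\<^esub> r \<in> H"

definition right_span ::
    "('r, 'z) ring_scheme \<Rightarrow> ('r, 'm, 'w) rmodule_scheme \<Rightarrow> 'm set \<Rightarrow> 'm set"
  where "right_span R M S = \<Inter>{H. right_submodule H R M \<and> S \<subseteq> H}"

definition right_fin_gen :: "('r, 'z) ring_scheme \<Rightarrow> ('r, 'm, 'w) rmodule_scheme \<Rightarrow> bool"
  where "right_fin_gen R M \<longleftrightarrow>
    (\<exists>S. finite S \<and> S \<subseteq> carrier M \<and> carrier M = right_span R M S)"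

definition bimodule_hom ::
    "('r, 'z) ring_scheme \<Rightarrow> ('r, 'm, 'v) bimodule_scheme \<Rightarrow> ('r, 'n, 'w) bimodule_scheme
      \<Rightarrow> ('m \<Rightarrow> 'n) set"
  where "bimodule_hom R M N =
    {f \<in> carrier M \<rightarrow> carrier N.
      (\<forall>x\<in>carrier M. \<forall>y\<in>carrier M. f (x \<oplus>\<^bsub>M\<^esub> y) = f x \<oplus>\<^bsub>N\<^esub> f y) \<and>
      (\<forall>r\<in>carrier R. \<forall>x\<in>carrier M. f (r \<triangleright>\<^bsub>M\<^esub> x) = r \<triangleright>\<^bsub>N\<^esub> f x) \<and>
      (\<forall>x\<in>carrier M. \<forall>r\<in>carrier R. f (x \<triangleleft>\<^bsub>M\<^esub> r) = f x \<triangleleft>\<^bsub>N\<^esub> r)}"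

definition regular_bimodule :: "('r, 'z) ring_scheme \<Rightarrow> ('r, 'r) bimodule"
  where "regular_bimodule R =
    \<lparr>carrier = carrier R, monoid.mult = monoid.mult R, monoid.one = \<one>\<^bsub>R\<^esub>, ring.zero = \<zero>\<^bsub>R\<^esub>, ring.add = ring.add R,
     rsmult = monoid.mult R, lsmult = monoid.mult R\<rparr>"


section \<open>Tensor products\<close>

text \<open>
  \<open>M \<otimes>\<^sub>R N\<close> is the free abelian group on pairs modulo the usual relations; its elements are cosets.
  As in the library's quotient groups, the group operation is written multiplicatively.
\<close>

definition tensor_generators ::
    "('r, 'z) ring_scheme \<Rightarrow> ('r, 'm, 'v) rmodule_scheme \<Rightarrow> ('r, 'n, 'w) bimodule_scheme
      \<Rightarrow> ('m \<times> 'n \<Rightarrow>\<^sub>0 int) set"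
  where "tensor_generators R M N =
    {frag_of (x \<oplus>\<^bsub>M\<^esub> x', y) - (frag_of (x, y) + frag_of (x', y)) | x x' y.
        x \<in> carrier M \<and> x' \<in> carrier M \<and> y \<in> carrier N} \<union>
    {frag_of (x, y \<oplus>\<^bsub>N\<^esub> y') - (frag_of (x, y) + frag_of (x, y')) | x y y'.
        x \<in> carrier M \<and> y \<in> carrier N \<and> y' \<in> carrier N} \<union>
    {frag_of (x \<triangleleft>\<^bsub>M\<^esub> r, y) - frag_of (x, r \<triangleright>\<^bsub>N\<^esub> y) | x r y.
        x \<in> carrier M \<and> r \<in> carrier R \<and> y \<in> carrier N}"

definition tensor_relations ::
    "('r, 'z) ring_scheme \<Rightarrow> ('r, 'm, 'v) rmodule_scheme \<Rightarrow> ('r, 'n, 'w) bimodule_scheme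
      \<Rightarrow> ('m \<times> 'n \<Rightarrow>\<^sub>0 int) set"
  where "tensor_relations R M N =
    generate (free_Abelian_group (carrier M \<times> carrier N)) (tensor_generators R M N)"

definition tensor ::
    "('r, 'z) ring_scheme \<Rightarrow> ('r, 'm, 'v) rmodule_scheme \<Rightarrow> ('r, 'n, 'w) bimodule_scheme
      \<Rightarrow> ('m \<times> 'n \<Rightarrow>\<^sub>0 int) set monoid"
  where "tensor R M N =
    free_Abelian_group (carrier M \<times> carrier N) Mod tensor_relations R M N"

definition pure_tensor ::
    "('r, 'z) ring_scheme \<Rightarrow> ('r, 'm, 'v) rmodule_scheme \<Rightarrow> ('r, 'n, 'w) bimodule_scheme
      \<Rightarrow> 'm \<Rightarrow> 'n \<Rightarrow> ('m \<times> 'n \<Rightarrow>\<^sub>0 int) set"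
  where "pure_tensor R M N x y =
    tensor_relations R M N #>\<^bsub>free_Abelian_group (carrier M \<times> carrier N)\<^esub> frag_of (x, y)"

text \<open>
  The homomorphism \<open>M \<otimes>\<^sub>R N \<rightarrow> G\<close>, \<open>x \<otimes> y \<mapsto> \<beta> x y\<close>, induced by a balanced biadditive map \<open>\<beta>\<close>:
  \<open>frag_eval\<close> is constant on the elements of each coset (see \<open>tensor_lift_coset\<close> below).
\<close>

definition frag_eval :: "('g, 'z) monoid_scheme \<Rightarrow> ('a \<Rightarrow> 'g) \<Rightarrow> ('a \<Rightarrow>\<^sub>0 int) \<Rightarrow> 'g"
  where "frag_eval G f z =
    (\<Otimes>\<^bsub>G\<^esub>p\<in>Poly_Mapping.keys z. f p [^]\<^bsub>G\<^esub> Poly_Mapping.lookup z p)"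

definition tensor_lift ::
    "('g, 'z) monoid_scheme \<Rightarrow> ('m \<Rightarrow> 'n \<Rightarrow> 'g) \<Rightarrow> ('m \<times> 'n \<Rightarrow>\<^sub>0 int) set \<Rightarrow> 'g"
  where "tensor_lift G \<beta> t = the_elem (frag_eval G (case_prod \<beta>) ` t)"

text \<open>\<open>f \<otimes> g\<close>, as a map into \<open>M' \<otimes>\<^sub>R N'\<close>.\<close>

definition tensor_map ::
    "('r, 'z) ring_scheme \<Rightarrow> ('r, 'm', 'v) rmodule_scheme \<Rightarrow> ('r, 'n', 'w) bimodule_scheme
      \<Rightarrow> ('m \<Rightarrow> 'm') \<Rightarrow> ('n \<Rightarrow> 'n')
      \<Rightarrow> ('m \<times> 'n \<Rightarrow>\<^sub>0 int) set \<Rightarrow> ('m' \<times> 'n' \<Rightarrow>\<^sub>0 int) set"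
  where "tensor_map R M' N' f g =
    tensor_lift (tensor R M' N') (\<lambda>x y. pure_tensor R M' N' (f x) (g y))"

definition tensor_bimodule ::
    "('r, 'z) ring_scheme \<Rightarrow> ('r, 'm, 'v) bimodule_scheme \<Rightarrow> ('r, 'n, 'w) bimodule_scheme
      \<Rightarrow> ('r, ('m \<times> 'n \<Rightarrow>\<^sub>0 int) set) bimodule"
  where "tensor_bimodule R M N =
    \<lparr>carrier = carrier (tensor R M N), monoid.mult = undefined, monoid.one = undefined,
     ring.zero = \<one>\<^bsub>tensor R M N\<^esub>, ring.add = monoid.mult (tensor R M N),
     rsmult = (\<lambda>t r. tensor_map R M N (\<lambda>x. x) (\<lambda>y. y \<triangleleft>\<^bsub>N\<^esub> r) t),
     lsmult = (\<lambda>r t. tensor_map R M N (\<lambda>x. r \<triangleright>\<^bsub>M\<^esub> x) (\<lambda>y. y) t)\<rparr>"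

text \<open>The canonical map \<open>(L \<otimes> M) \<otimes> N \<rightarrow> L \<otimes> (M \<otimes> N)\<close>.\<close>

definition tensor_assoc ::
    "('r, 'z) ring_scheme \<Rightarrow> ('r, 'l, 'u) bimodule_scheme \<Rightarrow> ('r, 'm, 'v) bimodule_scheme
      \<Rightarrow> ('r, 'n, 'w) bimodule_scheme
      \<Rightarrow> (('l \<times> 'm \<Rightarrow>\<^sub>0 int) set \<times> 'n \<Rightarrow>\<^sub>0 int) set
      \<Rightarrow> ('l \<times> ('m \<times> 'n \<Rightarrow>\<^sub>0 int) set \<Rightarrow>\<^sub>0 int) set"
  where "tensor_assoc R L M N =
    (let T = tensor R L (tensor_bimodule R M N) in
      tensor_lift T (\<lambda>s z. tensor_lift T
        (\<lambda>x y. pure_tensor R L (tensor_bimodule R M N) x (pure_tensor R M N y z)) s))"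


section \<open>Rings over \<open>R\<close> and corings over \<open>R\<close>\<close>

text \<open>
  The unit map is \<open>r \<mapsto> r \<triangleright> \<one> = \<one> \<triangleleft> r\<close>; the last equality is an instance of \<open>mult_balanced\<close>.
\<close>

locale R_ring = bimodule R A + A?: ring A
  for R :: "('r, 'z) ring_scheme" (structure) and A :: "('r, 'a, 'v) bimodule_scheme" (structure) +
  assumes mult_lsmult:
      "\<lbrakk>r \<in> carrier R; a \<in> carrier A; b \<in> carrier A\<rbrakk> \<Longrightarrow>
        (r \<triangleright>\<^bsub>A\<^esub> a) \<otimes>\<^bsub>A\<^esub> b = r \<triangleright>\<^bsub>A\<^esub> (a \<otimes>\<^bsub>A\<^esub> b)"
    and mult_rsmult:
      "\<lbrakk>a \<in> carrier A; b \<in> carrier A; r \<in> carrier R\<rbrakk> \<Longrightarrow>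
        a \<otimes>\<^bsub>A\<^esub> (b \<triangleleft>\<^bsub>A\<^esub> r) = (a \<otimes>\<^bsub>A\<^esub> b) \<triangleleft>\<^bsub>A\<^esub> r"
    and mult_balanced:
      "\<lbrakk>a \<in> carrier A; r \<in> carrier R; b \<in> carrier A\<rbrakk> \<Longrightarrow>
        (a \<triangleleft>\<^bsub>A\<^esub> r) \<otimes>\<^bsub>A\<^esub> b = a \<otimes>\<^bsub>A\<^esub> (r \<triangleright>\<^bsub>A\<^esub> b)"

definition R_ring_hom ::
    "('r, 'z) ring_scheme \<Rightarrow> ('r, 'a, 'v) bimodule_scheme \<Rightarrow> ('r, 'b, 'w) bimodule_scheme
      \<Rightarrow> ('a \<Rightarrow> 'b) set"
  where "R_ring_hom R A B = ring_hom A B \<inter> bimodule_hom R A B"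

record ('r, 'c) coring = "('r, 'c) bimodule" +
  comult :: "'c \<Rightarrow> ('c \<times> 'c \<Rightarrow>\<^sub>0 int) set"
  counit :: "'c \<Rightarrow> 'r"

locale R_coring = bimodule R C
  for R :: "('r, 'z) ring_scheme" (structure) and C :: "('r, 'c, 'w) coring_scheme" (structure) +
  assumes comult_hom: "comult C \<in> bimodule_hom R C (tensor_bimodule R C C)"
    and counit_hom: "counit C \<in> bimodule_hom R C (regular_bimodule R)"
    and coassoc: "c \<in> carrier C \<Longrightarrow>
      tensor_assoc R C C C
        (tensor_map R (tensor_bimodule R C C) C (comult C) (\<lambda>d. d) (comult C c)) =
      tensor_map R C (tensor_bimodule R C C) (\<lambda>d. d) (comult C) (comult C c)"
    and counit_l: "c \<in> carrier C \<Longrightarrow>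
      tensor_lift (add_monoid C) (\<lambda>c1 c2. counit C c1 \<triangleright>\<^bsub>C\<^esub> c2) (comult C c) = c"
    and counit_r: "c \<in> carrier C \<Longrightarrow>
      tensor_lift (add_monoid C) (\<lambda>c1 c2. c1 \<triangleleft>\<^bsub>C\<^esub> counit C c2) (comult C c) = c"

text \<open>The left dual \<open>\<^sup>*C\<close>.  Its elements are functions undefined off the carrier, so that equality
  in the dual is pointwise equality on \<open>C\<close>.\<close>

definition left_dual ::
    "('r, 'z) ring_scheme \<Rightarrow> ('r, 'c, 'w) coring_scheme \<Rightarrow> ('r, 'c \<Rightarrow> 'r) bimodule"
  where "left_dual R C =
    \<lparr>carrier = {f \<in> carrier C \<rightarrow>\<^sub>E carrier R.
       (\<forall>c\<in>carrier C. \<forall>d\<in>carrier C. f (c \<oplus>\<^bsub>C\<^esub> d) = f c \<oplus>\<^bsub>R\<^esub> f d) \<and>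
       (\<forall>r\<in>carrier R. \<forall>c\<in>carrier C. f (r \<triangleright>\<^bsub>C\<^esub> c) = r \<otimes>\<^bsub>R\<^esub> f c)},
     monoid.mult = (\<lambda>f g. \<lambda>c\<in>carrier C.
       tensor_lift (add_monoid R) (\<lambda>c1 c2. g (c1 \<triangleleft>\<^bsub>C\<^esub> f c2)) (comult C c)),
     monoid.one = (\<lambda>c\<in>carrier C. counit C c),
     ring.zero = (\<lambda>c\<in>carrier C. \<zero>\<^bsub>R\<^esub>),
     ring.add = (\<lambda>f g. \<lambda>c\<in>carrier C. f c \<oplus>\<^bsub>R\<^esub> g c),
     rsmult = (\<lambda>f r. \<lambda>c\<in>carrier C. f c \<otimes>\<^bsub>R\<^esub> r),
     lsmult = (\<lambda>r f. \<lambda>c\<in>carrier C. f (c \<triangleleft>\<^bsub>C\<^esub> r))\<rparr>"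


section \<open>Measuring \<open>\<alpha>\<close>-pairings, rational modules and coideals\<close>

text \<open>\<open>\<alpha>\<^sub>M(m \<otimes> c) = [a \<mapsto> m\<langle>a, c\<rangle>]\<close>, where \<open>\<langle>a, c\<rangle> = \<kappa> a c\<close>.\<close>

definition alpha_map ::
    "('a, 'v) partial_object_scheme \<Rightarrow> ('a \<Rightarrow> 'c \<Rightarrow> 'r) \<Rightarrow> ('r, 'm, 'w) rmodule_scheme
      \<Rightarrow> ('m \<times> 'c \<Rightarrow>\<^sub>0 int) set \<Rightarrow> 'a \<Rightarrow> 'm"
  where "alpha_map A \<kappa> M t =
    (\<lambda>a\<in>carrier A. tensor_lift (add_monoid M) (\<lambda>m c. m \<triangleleft>\<^bsub>M\<^esub> \<kappa> a c) t)"

text \<open>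
  HOL cannot quantify over the type of \<open>M\<close> inside a definition.  In \<open>alpha_inj\<close> the module \<open>M\<close>
  ranges over the right modules on subsets of the type \<open>(nat \<Rightarrow> 'r) set\<close>, which contains an
  isomorphic copy of every finitely generated right \<open>R\<close>-module.  Lemma \<open>alpha_inj_all\<close> below shows
  that injectivity then holds for right \<open>R\<close>-modules on every type.
\<close>

locale measuring_left_pairing = A?: R_ring R A + C?: R_coring R C
  for R :: "('r, 'z) ring_scheme" (structure) and A :: "('r, 'a, 'v) bimodule_scheme" (structure)
    and C :: "('r, 'c, 'w) coring_scheme" (structure) and \<kappa> :: "'a \<Rightarrow> 'c \<Rightarrow> 'r" +
  assumes kappa_hom: "\<kappa> \<in> R_ring_hom R A (left_dual R C)"

locale measuring_left_alpha_pairing = measuring_left_pairing R A C \<kappa>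
  for R :: "('r, 'z) ring_scheme" (structure) and A :: "('r, 'a, 'v) bimodule_scheme" (structure)
    and C :: "('r, 'c, 'w) coring_scheme" (structure) and \<kappa> :: "'a \<Rightarrow> 'c \<Rightarrow> 'r" +
  assumes alpha_inj: "\<And>M :: ('r, (nat \<Rightarrow> 'r) set) rmodule.
      right_module R M \<Longrightarrow> inj_on (alpha_map A \<kappa> M) (carrier (tensor R M C))"

text \<open>A right \<open>A\<close>-module as a right \<open>R\<close>-module, via the unit map of the \<open>R\<close>-ring \<open>A\<close>.\<close>

definition restrict_scalars ::
    "('r, 'a, 'v) bimodule_scheme \<Rightarrow> ('a, 'm, 'w) rmodule_scheme \<Rightarrow> ('r, 'm) rmodule"
  where "restrict_scalars A M =
    \<lparr>carrier = carrier M, monoid.mult = monoid.mult M, monoid.one = \<one>\<^bsub>M\<^esub>, ring.zero = \<zero>\<^bsub>M\<^esub>, ring.add = ring.add M,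
     rsmult = (\<lambda>m r. m \<triangleleft>\<^bsub>M\<^esub> (r \<triangleright>\<^bsub>A\<^esub> \<one>\<^bsub>A\<^esub>))\<rparr>"

definition rational_module ::
    "('r, 'z) ring_scheme \<Rightarrow> ('r, 'a, 'v) bimodule_scheme \<Rightarrow> ('r, 'c, 'w) coring_scheme
      \<Rightarrow> ('a \<Rightarrow> 'c \<Rightarrow> 'r) \<Rightarrow> ('a, 'm, 'u) rmodule_scheme \<Rightarrow> bool"
  where "rational_module R A C \<kappa> M \<longleftrightarrow> right_module A M \<and>
    (\<forall>m\<in>carrier M. \<exists>t\<in>carrier (tensor R (restrict_scalars A M) C).
      \<forall>a\<in>carrier A. m \<triangleleft>\<^bsub>M\<^esub> a = alpha_map A \<kappa> (restrict_scalars A M) t a)"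

definition right_coideal ::
    "('r, 'z) ring_scheme \<Rightarrow> ('r, 'c, 'w) coring_scheme \<Rightarrow> 'c set \<Rightarrow> bool"
  where "right_coideal R C K \<longleftrightarrow> right_submodule K R C \<and>
    comult C ` K \<subseteq>
      tensor_map R C C (\<lambda>x. x) (\<lambda>y. y) ` carrier (tensor R (C\<lparr>carrier := K\<rparr>) C)"

section \<open>Basic facts\<close>

lemma (in comm_group) frag_eval_superset:
  assumes "finite I" "Poly_Mapping.keys z \<subseteq> I" "f \<in> I \<rightarrow> carrier G"
  shows "frag_eval G f z = (\<Otimes>p\<in>I. f p [^] Poly_Mapping.lookup z p)"
  unfolding frag_eval_def
  by (rule finprod_mono_neutral_cong_left) (use assms in \<open>auto simp: in_keys_iff\<close>)

lemma (in comm_group) frag_eval_hom: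
  assumes f: "f \<in> S \<rightarrow> carrier G"
  shows "frag_eval G f \<in> hom (free_Abelian_group S) G"
proof (rule homI)
  fix x assume "x \<in> carrier (free_Abelian_group S)"
  then have "f \<in> Poly_Mapping.keys x \<rightarrow> carrier G"
    using f by auto
  then show "frag_eval G f x \<in> carrier G"
    unfolding frag_eval_def by (auto intro!: finprod_closed simp: Pi_def)
next
  fix x y
  assume "x \<in> carrier (free_Abelian_group S)" "y \<in> carrier (free_Abelian_group S)"
  then have xy: "Poly_Mapping.keys x \<subseteq> S" "Poly_Mapping.keys y \<subseteq> S" by auto
  define I where "I = Poly_Mapping.keys x \<union> Poly_Mapping.keys y"
  have I: "finite I" "f \<in> I \<rightarrow> carrier G"
    using f xy by (auto simp: I_def)
  have k: "Poly_Mapping.keys x \<subseteq> I" "Poly_Mapping.keys y \<subseteq> I" "Poly_Mapping.keys (x + y) \<subseteq> I"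
    using keys_add[of x y] by (auto simp: I_def)
  have "frag_eval G f (x + y) =
      (\<Otimes>p\<in>I. f p [^] Poly_Mapping.lookup x p \<otimes> f p [^] Poly_Mapping.lookup y p)"
    unfolding frag_eval_superset[OF I(1) k(3) I(2)]
    by (rule finprod_cong') (use I in \<open>auto simp: lookup_add int_pow_mult Pi_iff\<close>)
  also have "\<dots> = frag_eval G f x \<otimes> frag_eval G f y"
    unfolding frag_eval_superset[OF I(1) k(1) I(2)] frag_eval_superset[OF I(1) k(2) I(2)]
    by (rule finprod_multf) (use I in \<open>auto simp: Pi_iff\<close>)
  finally show "frag_eval G f (x \<otimes>\<^bsub>free_Abelian_group S\<^esub> y) = frag_eval G f x \<otimes> frag_eval G f y"
    by simp
qed

lemma (in comm_group) frag_eval_zero: "frag_eval G f 0 = \<one>"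
  by (simp add: frag_eval_def)

lemma (in comm_group) frag_eval_frag_of:
  assumes "f p \<in> carrier G"
  shows "frag_eval G f (frag_of p) = f p"
  using assms by (simp add: frag_eval_def)

lemma free_Abelian_group_hom_eqI:
  assumes G: "group G" and h: "h \<in> hom (free_Abelian_group S) G"
    and k: "k \<in> hom (free_Abelian_group S) G"
    and eq: "\<And>p. p \<in> S \<Longrightarrow> h (frag_of p) = k (frag_of p)"
    and z: "Poly_Mapping.keys z \<subseteq> S"
  shows "h z = k z"
proof -
  interpret h: group_hom "free_Abelian_group S" G h
    using h G by (simp add: group_hom_def group_hom_axioms_def)
  interpret k: group_hom "free_Abelian_group S" G k
    using k G by (simp add: group_hom_def group_hom_axioms_def)
  have "Poly_Mapping.keys z \<subseteq> S \<and> h z = k z"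
    using z
  proof (induction rule: frag_induction)
    case zero
    then show ?case using h.hom_one k.hom_one by simp
  next
    case (one x)
    then show ?case using eq by simp
  next
    case (diff a b)
    then have a: "a \<in> carrier (free_Abelian_group S)" and b: "- b \<in> carrier (free_Abelian_group S)"
      and b': "b \<in> carrier (free_Abelian_group S)"
      by (auto simp: keys_minus)
    have "h (a - b) = h a \<otimes>\<^bsub>G\<^esub> inv\<^bsub>G\<^esub> h b"
      using h.hom_mult[OF a b] h.hom_inv[OF b'] diff by simp
    moreover have "k (a - b) = k a \<otimes>\<^bsub>G\<^esub> inv\<^bsub>G\<^esub> k b"
      using k.hom_mult[OF a b] k.hom_inv[OF b'] diff by simp
    ultimately show ?case
      using diff keys_diff[of a b] by auto
  qed
  then show ?thesis ..
qed

definition balanced_map ::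
    "('r, 'z) ring_scheme \<Rightarrow> ('r, 'm, 'v) rmodule_scheme \<Rightarrow> ('r, 'n, 'w) bimodule_scheme
      \<Rightarrow> ('g, 'y) monoid_scheme \<Rightarrow> ('m \<Rightarrow> 'n \<Rightarrow> 'g) \<Rightarrow> bool"
  where "balanced_map R M N G \<beta> \<longleftrightarrow>
    (\<forall>x\<in>carrier M. \<forall>y\<in>carrier N. \<beta> x y \<in> carrier G) \<and>
    (\<forall>x\<in>carrier M. \<forall>x'\<in>carrier M. \<forall>y\<in>carrier N.
      \<beta> (x \<oplus>\<^bsub>M\<^esub> x') y = \<beta> x y \<otimes>\<^bsub>G\<^esub> \<beta> x' y) \<and>
    (\<forall>x\<in>carrier M. \<forall>y\<in>carrier N. \<forall>y'\<in>carrier N.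
      \<beta> x (y \<oplus>\<^bsub>N\<^esub> y') = \<beta> x y \<otimes>\<^bsub>G\<^esub> \<beta> x y') \<and>
    (\<forall>x\<in>carrier M. \<forall>r\<in>carrier R. \<forall>y\<in>carrier N.
      \<beta> (x \<triangleleft>\<^bsub>M\<^esub> r) y = \<beta> x (r \<triangleright>\<^bsub>N\<^esub> y))"

lemma tensor_generators_cases:
  assumes "z \<in> tensor_generators R M N"
  obtains
    (add_l) x x' y where "x \<in> carrier M" "x' \<in> carrier M" "y \<in> carrier N"
      "z = frag_of (x \<oplus>\<^bsub>M\<^esub> x', y) - (frag_of (x, y) + frag_of (x', y))"
  | (add_r) x y y' where "x \<in> carrier M" "y \<in> carrier N" "y' \<in> carrier N"
      "z = frag_of (x, y \<oplus>\<^bsub>N\<^esub> y') - (frag_of (x, y) + frag_of (x, y'))"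
  | (smult) x r y where "x \<in> carrier M" "r \<in> carrier R" "y \<in> carrier N"
      "z = frag_of (x \<triangleleft>\<^bsub>M\<^esub> r, y) - frag_of (x, r \<triangleright>\<^bsub>N\<^esub> y)"
  using assms unfolding tensor_generators_def by blast

lemma tensor_generators_in_carrier:
  assumes "right_module R M" "left_module R N"
  shows "tensor_generators R M N \<subseteq> carrier (free_Abelian_group (carrier M \<times> carrier N))"
    (is "_ \<subseteq> ?F")
proof
  interpret M: right_module R M by fact
  interpret N: left_module R N by fact
  have d: "a - b \<in> ?F" if "a \<in> ?F" "b \<in> ?F" for a b
    using that keys_diff[of a b] by auto
  have s: "a + b \<in> ?F" if "a \<in> ?F" "b \<in> ?F" for a b
    using that keys_add[of a b] by auto
  have p: "frag_of (x, y) \<in> ?F" if "x \<in> carrier M" "y \<in> carrier N" for x y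
    using that by simp
  fix z assume "z \<in> tensor_generators R M N"
  then show "z \<in> ?F"
    by (cases z rule: tensor_generators_cases) (simp_all only:, (intro d s p; simp)+)
qed

lemma tensor_relations_subgroup:
  assumes "right_module R M" "left_module R N"
  shows "subgroup (tensor_relations R M N) (free_Abelian_group (carrier M \<times> carrier N))"
  unfolding tensor_relations_def
  by (rule group.generate_is_subgroup[OF group_free_Abelian_group
        tensor_generators_in_carrier[OF assms]])

lemma tensor_relations_keys:
  assumes "right_module R M" "left_module R N" "z \<in> tensor_relations R M N"
  shows "Poly_Mapping.keys z \<subseteq> carrier M \<times> carrier N"
  using subsetD[OF subgroup.subset[OF tensor_relations_subgroup[OF assms(1,2)]] assms(3)] by simp

lemma hom_diff_eq_one:
  assumes G: "comm_group G" and h: "h \<in> hom (free_Abelian_group S) G"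
    and ab: "Poly_Mapping.keys a \<subseteq> S" "Poly_Mapping.keys b \<subseteq> S" and eq: "h a = h b"
  shows "h (a - b) = \<one>\<^bsub>G\<^esub>"
proof -
  interpret G: comm_group G by fact
  interpret h: group_hom "free_Abelian_group S" G h
    using h by (simp add: group_hom_def group_hom_axioms_def G.is_group)
  have a: "a \<in> carrier (free_Abelian_group S)" and b: "b \<in> carrier (free_Abelian_group S)"
      and b': "- b \<in> carrier (free_Abelian_group S)"
    using ab by (auto simp: keys_minus)
  have "h (a - b) = h a \<otimes>\<^bsub>G\<^esub> inv\<^bsub>G\<^esub> h b"
    using h.hom_mult[OF a b'] h.hom_inv[OF b] ab by simp
  then show ?thesis
    using eq h.hom_closed[OF b] by simp
qed

lemma frag_eval_tensor_relations:
  assumes M: "right_module R M" and N: "left_module R N" and G: "comm_group G"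
    and \<beta>: "balanced_map R M N G \<beta>" and z: "z \<in> tensor_relations R M N"
  shows "frag_eval G (case_prod \<beta>) z = \<one>\<^bsub>G\<^esub>"
proof -
  interpret M: right_module R M by fact
  interpret N: left_module R N by fact
  interpret G: comm_group G by fact
  let ?S = "carrier M \<times> carrier N"
  let ?h = "frag_eval G (case_prod \<beta>)"
  have cl: "case_prod \<beta> \<in> ?S \<rightarrow> carrier G"
    using \<beta> by (auto simp: balanced_map_def)
  have h: "?h \<in> hom (free_Abelian_group ?S) G"
    by (rule G.frag_eval_hom[OF cl])
  interpret h: group_hom "free_Abelian_group ?S" G ?h
    using h by (simp add: group_hom_def group_hom_axioms_def G.is_group)
  have of: "?h (frag_of (x, y)) = \<beta> x y" if "x \<in> carrier M" "y \<in> carrier N" for x y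
  proof -
    have "\<beta> x y \<in> carrier G" using \<beta> that by (auto simp: balanced_map_def)
    then show ?thesis using G.frag_eval_frag_of[of "case_prod \<beta>" "(x, y)"] by simp
  qed
  have p: "Poly_Mapping.keys (frag_of (x, y)) \<subseteq> ?S" if "x \<in> carrier M" "y \<in> carrier N" for x y
    using that by simp
  have add: "?h (a + b) = ?h a \<otimes>\<^bsub>G\<^esub> ?h b"
    if "Poly_Mapping.keys a \<subseteq> ?S" "Poly_Mapping.keys b \<subseteq> ?S" for a b
    using h.hom_mult[of a b] that by simp
  have ka: "Poly_Mapping.keys (frag_of (x, y) + frag_of (x', y')) \<subseteq> ?S"
    if "x \<in> carrier M" "y \<in> carrier N" "x' \<in> carrier M" "y' \<in> carrier N" for x y x' y'
    using that keys_add[of "frag_of (x, y)" "frag_of (x', y')"] by auto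
  have gen: "?h z = \<one>\<^bsub>G\<^esub>" if "z \<in> tensor_generators R M N" for z
    using that
  proof (cases z rule: tensor_generators_cases)
    case (add_l x x' y)
    have "?h (frag_of (x \<oplus>\<^bsub>M\<^esub> x', y)) = ?h (frag_of (x, y) + frag_of (x', y))"
      using add_l \<beta> by (simp add: of add p balanced_map_def)
    then show ?thesis
      unfolding add_l(4) by (intro hom_diff_eq_one[OF G h] p ka) (use add_l in auto)
  next
    case (add_r x y y')
    have "?h (frag_of (x, y \<oplus>\<^bsub>N\<^esub> y')) = ?h (frag_of (x, y) + frag_of (x, y'))"
      using add_r \<beta> by (simp add: of add p balanced_map_def)
    then show ?thesis
      unfolding add_r(4) by (intro hom_diff_eq_one[OF G h] p ka) (use add_r in auto)
  next
    case (smult x r y)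
    have "?h (frag_of (x \<triangleleft>\<^bsub>M\<^esub> r, y)) = ?h (frag_of (x, r \<triangleright>\<^bsub>N\<^esub> y))"
      using smult \<beta> by (simp add: of balanced_map_def)
    then show ?thesis
      unfolding smult(4) by (intro hom_diff_eq_one[OF G h] p) (use smult in auto)
  qed
  show ?thesis
    using z unfolding tensor_relations_def
  proof (induction rule: generate.induct)
    case one
    then show ?case using h.hom_one by simp
  next
    case (incl z)
    then show ?case by (rule gen)
  next
    case (inv z)
    then have "z \<in> carrier (free_Abelian_group ?S)"
      using tensor_generators_in_carrier[OF M N] by blast
    then show ?case
      using h.hom_inv[of z] gen[OF inv] by simp
  next
    case (eng z1 z2)
    have "z1 \<in> carrier (free_Abelian_group ?S)" "z2 \<in> carrier (free_Abelian_group ?S)"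
      using eng(1,2) group.generate_in_carrier[OF group_free_Abelian_group
        tensor_generators_in_carrier[OF M N]] by blast+
    then show ?case
      using eng h.hom_mult[of z1 z2] by simp
  qed
qed

lemma tensor_lift_coset:
  assumes M: "right_module R M" and N: "left_module R N" and G: "comm_group G"
    and \<beta>: "balanced_map R M N G \<beta>" and z: "Poly_Mapping.keys z \<subseteq> carrier M \<times> carrier N"
  shows "tensor_lift G \<beta>
      (tensor_relations R M N #>\<^bsub>free_Abelian_group (carrier M \<times> carrier N)\<^esub> z) =
    frag_eval G (case_prod \<beta>) z"
proof -
  interpret G: comm_group G by fact
  let ?S = "carrier M \<times> carrier N"
  let ?h = "frag_eval G (case_prod \<beta>)"
  have cl: "case_prod \<beta> \<in> ?S \<rightarrow> carrier G"
    using \<beta> by (auto simp: balanced_map_def)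
  have h: "?h \<in> hom (free_Abelian_group ?S) G"
    by (rule G.frag_eval_hom[OF cl])
  have zc: "?h z \<in> carrier G"
    using hom_in_carrier[OF h] z by simp
  have *: "?h (k + z) = ?h z" if "k \<in> tensor_relations R M N" for k
    using hom_mult[OF h, of k z] tensor_relations_keys[OF M N that] z zc
      frag_eval_tensor_relations[OF M N G \<beta> that] by simp
  have "0 \<in> tensor_relations R M N"
    using subgroup.one_closed[OF tensor_relations_subgroup[OF M N]] by simp
  then have "?h ` (tensor_relations R M N #>\<^bsub>free_Abelian_group ?S\<^esub> z) = {?h z}"
    unfolding r_coset_def using * by force
  then show ?thesis
    by (simp add: tensor_lift_def)
qed

lemma tensor_lift_pure:
  assumes "right_module R M" "left_module R N" and G: "comm_group G"
    and \<beta>: "balanced_map R M N G \<beta>" and "x \<in> carrier M" "y \<in> carrier N"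
  shows "tensor_lift G \<beta> (pure_tensor R M N x y) = \<beta> x y"
proof -
  interpret G: comm_group G by fact
  have "frag_eval G (case_prod \<beta>) (frag_of (x, y)) = \<beta> x y"
    using G.frag_eval_frag_of[of "case_prod \<beta>" "(x, y)"] assms(5,6) \<beta>
    by (auto simp: balanced_map_def)
  then show ?thesis
    unfolding pure_tensor_def using assms by (subst tensor_lift_coset) auto
qed


subsection \<open>Independence of the type of the modules in \<open>alpha_inj\<close>\<close>

lemma frag_extend_hom:
  assumes "\<And>p. p \<in> S \<Longrightarrow> f p \<in> T"
  shows "frag_extend (\<lambda>p. frag_of (f p)) \<in> hom (free_Abelian_group S) (free_Abelian_group T)"
proof (rule homI)
  fix z assume z: "z \<in> carrier (free_Abelian_group S)"
  show "frag_extend (\<lambda>p. frag_of (f p)) z \<in> carrier (free_Abelian_group T)"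
    using keys_frag_extend[of "\<lambda>p. frag_of (f p)" z] z assms by fastforce
qed (simp add: frag_extend_add)

lemma tensor_relations_map:
  assumes M: "right_module R M" and M': "right_module R M'" and N: "left_module R N"
    and cl: "\<And>x. x \<in> carrier M \<Longrightarrow> \<phi> x \<in> carrier M'"
    and ad: "\<And>x y. \<lbrakk>x \<in> carrier M; y \<in> carrier M\<rbrakk> \<Longrightarrow> \<phi> (x \<oplus>\<^bsub>M\<^esub> y) = \<phi> x \<oplus>\<^bsub>M'\<^esub> \<phi> y"
    and li: "\<And>x r. \<lbrakk>x \<in> carrier M; r \<in> carrier R\<rbrakk> \<Longrightarrow> \<phi> (x \<triangleleft>\<^bsub>M\<^esub> r) = \<phi> x \<triangleleft>\<^bsub>M'\<^esub> r"
    and z: "z \<in> tensor_relations R M N"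
  shows "frag_extend (\<lambda>p. frag_of (\<phi> (fst p), snd p)) z \<in> tensor_relations R M' N"
proof -
  let ?h = "frag_extend (\<lambda>p. frag_of (\<phi> (fst p), snd p))"
  have gen: "?h z \<in> tensor_generators R M' N" if "z \<in> tensor_generators R M N" for z
    using that
  proof (cases z rule: tensor_generators_cases)
    case (add_l x x' y)
    then have "?h z = frag_of (\<phi> x \<oplus>\<^bsub>M'\<^esub> \<phi> x', y) - (frag_of (\<phi> x, y) + frag_of (\<phi> x', y))"
      by (simp add: frag_extend_diff frag_extend_add ad)
    then show ?thesis
      unfolding tensor_generators_def using add_l cl by blast
  next
    case (add_r x y y')
    then have "?h z = frag_of (\<phi> x, y \<oplus>\<^bsub>N\<^esub> y') - (frag_of (\<phi> x, y) + frag_of (\<phi> x, y'))"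
      by (simp add: frag_extend_diff frag_extend_add)
    then show ?thesis
      unfolding tensor_generators_def using add_r cl by blast
  next
    case (smult x r y)
    then have "?h z = frag_of (\<phi> x \<triangleleft>\<^bsub>M'\<^esub> r, y) - frag_of (\<phi> x, r \<triangleright>\<^bsub>N\<^esub> y)"
      by (simp add: frag_extend_diff li)
    then show ?thesis
      unfolding tensor_generators_def using smult cl by blast
  qed
  have incl: "?h z \<in> tensor_relations R M' N" if "z \<in> tensor_generators R M N" for z
    unfolding tensor_relations_def by (rule generate.incl[OF gen[OF that]])
  show ?thesis
    using z unfolding tensor_relations_def[of R M]
  proof (induction rule: generate.induct)
    case one
    then show ?case
      using subgroup.one_closed[OF tensor_relations_subgroup[OF M' N]] by simp
  next
    case (incl z)
    then show ?case by fact
  next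
    case (inv z)
    have k: "Poly_Mapping.keys z \<subseteq> carrier M \<times> carrier N"
      using subsetD[OF tensor_generators_in_carrier[OF M N] inv] by simp
    have "- ?h z \<in> tensor_relations R M' N"
      using subgroup.m_inv_closed[OF tensor_relations_subgroup[OF M' N] incl[OF inv]]
        tensor_relations_keys[OF M' N incl[OF inv]] by simp
    then show ?case
      using k by (simp add: frag_extend_minus)
  next
    case (eng z1 z2)
    then show ?case
      using subgroup.m_closed[OF tensor_relations_subgroup[OF M' N]]
      by (simp add: frag_extend_add)
  qed
qed

definition transport_module ::
    "('r, 'm, 'w) rmodule_scheme \<Rightarrow> 'm set \<Rightarrow> ('m \<Rightarrow> 'u) \<Rightarrow> ('r, 'u) rmodule"
  where "transport_module M S g =
    \<lparr>carrier = g ` S, monoid.mult = undefined, monoid.one = undefined, ring.zero = g \<zero>\<^bsub>M\<^esub>,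
     ring.add = (\<lambda>u v. g (inv_into S g u \<oplus>\<^bsub>M\<^esub> inv_into S g v)),
     rsmult = (\<lambda>u r. g (inv_into S g u \<triangleleft>\<^bsub>M\<^esub> r))\<rparr>"

lemma right_module_transport:
  assumes M: "right_module R M" and S: "right_submodule S R M" and g: "inj_on g S"
  shows "right_module R (transport_module M S g)"
proof -
  interpret M: right_module R M by fact
  interpret S: right_submodule S R M by fact
  have SM: "x \<in> carrier M" if "x \<in> S" for x
    using S.subset that by auto
  have S0: "\<zero>\<^bsub>M\<^esub> \<in> S"
    using S.one_closed by simp
  have Sa: "x \<oplus>\<^bsub>M\<^esub> y \<in> S" if "x \<in> S" "y \<in> S" for x y
    using S.m_closed that by simp
  have Sm: "\<exists>y\<in>S. g (y \<oplus>\<^bsub>M\<^esub> x) = g \<zero>\<^bsub>M\<^esub>" if "x \<in> S" for x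
    using S.m_inv_closed[OF that] M.l_neg[OF SM[OF that]]
    by (intro bexI[of _ "\<ominus>\<^bsub>M\<^esub> x"]) (simp_all add: a_inv_def)
  have i: "inv_into S g (g x) = x" if "x \<in> S" for x
    using g that by simp
  have "abelian_group (transport_module M S g)"
    by (rule abelian_groupI)
      (auto simp: transport_module_def i S0 Sa SM Sm M.a_assoc intro!: arg_cong[of _ _ g] M.a_comm)
  then show ?thesis
    unfolding right_module_def right_module_axioms_def
    by (auto simp: M.R.ring_axioms transport_module_def i S0 Sa SM
        M.rsmult_l_distr M.rsmult_r_distr M.rsmult_assoc)
qed

lemma (in right_module) fin_gen_submodule:
  fixes Y :: "'m set"
  assumes Y: "finite Y" "Y \<subseteq> carrier M"
  obtains S and g :: "'m \<Rightarrow> (nat \<Rightarrow> 'r) set"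
  where "right_submodule S R M" "Y \<subseteq> S" "inj_on g S"
proof -
  obtain n and p :: "nat \<Rightarrow> 'm" where p: "Y = p ` {..<n}"
    using finite_imp_nat_seg_image_inj_on[OF Y(1)] by (metis lessThan_def)
  have pc: "p i \<in> carrier M" if "i < n" for i
    using p Y that by auto
  define e where "e v = (\<Oplus>\<^bsub>M\<^esub>i\<in>{..<n}. p i \<triangleleft>\<^bsub>M\<^esub> v i)" for v :: "nat \<Rightarrow> 'r"
  define V where "V = {..<n} \<rightarrow> carrier R"
  define S where "S = e ` V"
  define g where "g x = {v \<in> V. e v = x}" for x
  have ec: "e v \<in> carrier M" if "v \<in> V" for v
    using that pc by (auto simp: e_def V_def Pi_iff intro!: M.finsum_closed)
  have e0: "e (\<lambda>i. \<zero>\<^bsub>R\<^esub>) = \<zero>\<^bsub>M\<^esub>"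
  proof -
    have "p i \<triangleleft>\<^bsub>M\<^esub> \<zero>\<^bsub>R\<^esub> = \<zero>\<^bsub>M\<^esub>" if "i < n" for i
    proof -
      have "p i \<triangleleft>\<^bsub>M\<^esub> \<zero>\<^bsub>R\<^esub> \<oplus>\<^bsub>M\<^esub> p i \<triangleleft>\<^bsub>M\<^esub> \<zero>\<^bsub>R\<^esub> = p i \<triangleleft>\<^bsub>M\<^esub> \<zero>\<^bsub>R\<^esub>"
        using rsmult_r_distr[OF pc[OF that], of "\<zero>\<^bsub>R\<^esub>" "\<zero>\<^bsub>R\<^esub>"] by simp
      then show ?thesis
        using pc[OF that] by (metis M.add.r_cancel_one' R.zero_closed rsmult_closed)
    qed
    then show ?thesis
      unfolding e_def by (intro M.add.finprod_one_eqI) auto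
  qed
  have ea: "e v \<oplus>\<^bsub>M\<^esub> e w = e (\<lambda>i. v i \<oplus>\<^bsub>R\<^esub> w i)" if "v \<in> V" "w \<in> V" for v w
  proof -
    have "e v \<oplus>\<^bsub>M\<^esub> e w = (\<Oplus>\<^bsub>M\<^esub>i\<in>{..<n}. p i \<triangleleft>\<^bsub>M\<^esub> v i \<oplus>\<^bsub>M\<^esub> p i \<triangleleft>\<^bsub>M\<^esub> w i)"
      unfolding e_def using that pc
      by (intro M.finsum_addf[symmetric]) (auto simp: V_def Pi_iff)
    also have "\<dots> = e (\<lambda>i. v i \<oplus>\<^bsub>R\<^esub> w i)"
      unfolding e_def using that pc
      by (intro M.finsum_cong') (auto simp: V_def Pi_iff rsmult_r_distr)
    finally show ?thesis .
  qed
  have er: "e v \<triangleleft>\<^bsub>M\<^esub> r = e (\<lambda>i. v i \<otimes>\<^bsub>R\<^esub> r)" if v: "v \<in> V" and r: "r \<in> carrier R" for v r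
  proof -
    have hom: "(\<lambda>x. x \<triangleleft>\<^bsub>M\<^esub> r) \<in> hom (add_monoid M) (add_monoid M)"
      using r by (auto simp: hom_def rsmult_l_distr)
    have gh: "group_hom (add_monoid M) (add_monoid M) (\<lambda>x. x \<triangleleft>\<^bsub>M\<^esub> r)"
      using hom by (simp add: group_hom_def group_hom_axioms_def M.add.is_group)
    have zr: "\<zero>\<^bsub>M\<^esub> \<triangleleft>\<^bsub>M\<^esub> r = \<zero>\<^bsub>M\<^esub>"
      using group_hom.hom_one[OF gh] by simp
    have "(\<Oplus>\<^bsub>M\<^esub>i\<in>I. p i \<triangleleft>\<^bsub>M\<^esub> v i) \<triangleleft>\<^bsub>M\<^esub> r = (\<Oplus>\<^bsub>M\<^esub>i\<in>I. p i \<triangleleft>\<^bsub>M\<^esub> (v i \<otimes>\<^bsub>R\<^esub> r))"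
      if "finite I" "I \<subseteq> {..<n}" for I
      using that
    proof (induction I rule: finite_induct)
      case empty
      then show ?case by (simp add: zr)
    next
      case (insert i I)
      have vc: "v j \<in> carrier R" if "j < n" for j
        using v that by (auto simp: V_def)
      have c1: "(\<lambda>i. p i \<triangleleft>\<^bsub>M\<^esub> v i) \<in> I \<rightarrow> carrier M"
        and c2: "(\<lambda>i. p i \<triangleleft>\<^bsub>M\<^esub> (v i \<otimes>\<^bsub>R\<^esub> r)) \<in> I \<rightarrow> carrier M"
        using insert.prems pc vc r by auto
      have "i < n" using insert.prems by auto
      then have ci: "p i \<in> carrier M" "v i \<in> carrier R"
        using pc vc by auto
      have s1: "(\<Oplus>\<^bsub>M\<^esub>i\<in>I. p i \<triangleleft>\<^bsub>M\<^esub> v i) \<in> carrier M"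
        using c1 by (rule M.finsum_closed)
      show ?case
        using insert c1 c2 ci s1 r
        by (simp add: M.finsum_insert rsmult_l_distr rsmult_assoc)
    qed
    from this[of "{..<n}"] show ?thesis
      by (simp add: e_def)
  qed
  have S: "right_submodule S R M"
  proof (intro right_submodule.intro right_submodule_axioms.intro)
    show "subgroup S (add_monoid M)"
    proof (rule M.add.subgroupI)
      show "S \<subseteq> carrier M"
        using ec by (auto simp: S_def)
      show "S \<noteq> {}"
        by (auto simp: S_def V_def intro!: exI[of _ "\<lambda>i. \<zero>\<^bsub>R\<^esub>"])
    next
      fix a assume "a \<in> S"
      then obtain v where v: "v \<in> V" "a = e v" by (auto simp: S_def)
      let ?w = "\<lambda>i. \<ominus>\<^bsub>R\<^esub> v i"
      have w: "?w \<in> V" using v by (auto simp: V_def Pi_iff)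
      have "e (\<lambda>i. ?w i \<oplus>\<^bsub>R\<^esub> v i) = e (\<lambda>i. \<zero>\<^bsub>R\<^esub>)"
        unfolding e_def
        by (rule M.finsum_cong') (use v pc in \<open>auto simp: V_def Pi_iff R.l_neg\<close>)
      then have "e ?w \<oplus>\<^bsub>M\<^esub> a = \<zero>\<^bsub>M\<^esub>"
        using ea[OF w v(1)] e0 v by simp
      then have "\<ominus>\<^bsub>M\<^esub> a = e ?w"
        using ec[OF w] ec[OF v(1)] v(2) M.minus_equality by blast
      then show "\<ominus>\<^bsub>M\<^esub> a \<in> S" using w by (simp add: S_def)
    next
      fix a b assume "a \<in> S" "b \<in> S"
      then obtain v w where "v \<in> V" "a = e v" "w \<in> V" "b = e w" by (auto simp: S_def)
      moreover then have "(\<lambda>i. v i \<oplus>\<^bsub>R\<^esub> w i) \<in> V" by (auto simp: V_def Pi_iff)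
      ultimately show "a \<oplus>\<^bsub>M\<^esub> b \<in> S"
        using ea by (auto simp: S_def)
    qed
    fix x r assume "x \<in> S" and r: "r \<in> carrier R"
    then obtain v where "v \<in> V" "x = e v" by (auto simp: S_def)
    moreover then have "(\<lambda>i. v i \<otimes>\<^bsub>R\<^esub> r) \<in> V" using r by (auto simp: V_def Pi_iff)
    ultimately show "x \<triangleleft>\<^bsub>M\<^esub> r \<in> S"
      using er r by (auto simp: S_def)
  qed
  have "Y \<subseteq> S"
  proof
    fix x assume "x \<in> Y"
    then obtain j where j: "j < n" "x = p j" using p by auto
    let ?v = "\<lambda>i. if i = j then \<one>\<^bsub>R\<^esub> else \<zero>\<^bsub>R\<^esub>"
    have v: "?v \<in> V" by (auto simp: V_def)
    have z: "p i \<triangleleft>\<^bsub>M\<^esub> \<zero>\<^bsub>R\<^esub> = \<zero>\<^bsub>M\<^esub>" if "i < n" for i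
    proof -
      have "p i \<triangleleft>\<^bsub>M\<^esub> \<zero>\<^bsub>R\<^esub> \<oplus>\<^bsub>M\<^esub> p i \<triangleleft>\<^bsub>M\<^esub> \<zero>\<^bsub>R\<^esub> = p i \<triangleleft>\<^bsub>M\<^esub> \<zero>\<^bsub>R\<^esub>"
        using rsmult_r_distr[OF pc[OF that], of "\<zero>\<^bsub>R\<^esub>" "\<zero>\<^bsub>R\<^esub>"] by simp
      then show ?thesis
        using pc[OF that] by (metis M.add.r_cancel_one' R.zero_closed rsmult_closed)
    qed
    have "e ?v = (\<Oplus>\<^bsub>M\<^esub>i\<in>{..<n}. if j = i then p i else \<zero>\<^bsub>M\<^esub>)"
      unfolding e_def
      by (rule M.finsum_cong') (use pc z in \<open>auto\<close>)
    also have "\<dots> = p j"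
      using j pc by (intro M.add.finprod_singleton) auto
    finally show "x \<in> S" using v j by (metis S_def imageI)
  qed
  moreover have "inj_on g S"
    by (rule inj_onI) (auto simp: S_def g_def)
  ultimately show ?thesis using S that by blast
qed

lemma tensor_coset_eq_iff:
  assumes M: "right_module R M" and N: "left_module R N"
    and z: "Poly_Mapping.keys z \<subseteq> carrier M \<times> carrier N"
    and z': "Poly_Mapping.keys z' \<subseteq> carrier M \<times> carrier N"
  shows "tensor_relations R M N #>\<^bsub>free_Abelian_group (carrier M \<times> carrier N)\<^esub> z =
      tensor_relations R M N #>\<^bsub>free_Abelian_group (carrier M \<times> carrier N)\<^esub> z'
    \<longleftrightarrow> z - z' \<in> tensor_relations R M N"
proof -
  let ?F = "free_Abelian_group (carrier M \<times> carrier N)"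
  let ?T = "tensor_relations R M N"
  interpret F: group ?F by simp
  have T: "subgroup ?T ?F" by (rule tensor_relations_subgroup[OF M N])
  show ?thesis
  proof
    assume "?T #>\<^bsub>?F\<^esub> z = ?T #>\<^bsub>?F\<^esub> z'"
    moreover have "z \<in> ?T #>\<^bsub>?F\<^esub> z"
      using F.rcos_self[OF _ T, of z] z by simp
    ultimately obtain k where "k \<in> ?T" "z = k + z'"
      by (auto simp: r_coset_def)
    then show "z - z' \<in> ?T" by simp
  next
    assume "z - z' \<in> ?T"
    then have "z \<in> ?T #>\<^bsub>?F\<^esub> z'"
      by (auto simp: r_coset_def intro!: bexI[of _ "z - z'"])
    then show "?T #>\<^bsub>?F\<^esub> z = ?T #>\<^bsub>?F\<^esub> z'"
      using F.repr_independence[OF _ _ T, of z z'] z' by simp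
  qed
qed

lemma (in measuring_left_pairing) balanced_alpha:
  assumes M: "right_module R M" and a: "a \<in> carrier A"
  shows "balanced_map R M C (add_monoid M) (\<lambda>m c. m \<triangleleft>\<^bsub>M\<^esub> \<kappa> a c)"
proof -
  interpret M: right_module R M by fact
  have k: "\<kappa> a \<in> carrier (left_dual R C)"
    using kappa_hom a by (auto simp: R_ring_hom_def bimodule_hom_def)
  then have "\<kappa> a c \<in> carrier R" if "c \<in> carrier C" for c
    using that by (auto simp: left_dual_def)
  with k show ?thesis
    by (simp add: balanced_map_def left_dual_def M.rsmult_l_distr M.rsmult_r_distr M.rsmult_assoc)
qed

theorem (in measuring_left_alpha_pairing) alpha_inj_all:
  fixes M :: "('r, 'm, 'u) rmodule_scheme"
  assumes M: "right_module R M"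
  shows "inj_on (alpha_map A \<kappa> M) (carrier (tensor R M C))"
proof (rule inj_onI)
  fix t t'
  assume t: "t \<in> carrier (tensor R M C)" and t': "t' \<in> carrier (tensor R M C)"
    and eq: "alpha_map A \<kappa> M t = alpha_map A \<kappa> M t'"
  interpret M: right_module R M by fact
  have C: "left_module R C" by (rule C.left_module_axioms)
  let ?S = "carrier M \<times> carrier C"
  let ?F = "free_Abelian_group ?S"
  obtain z where z: "Poly_Mapping.keys z \<subseteq> ?S" "t = tensor_relations R M C #>\<^bsub>?F\<^esub> z"
    using t by (auto simp: tensor_def FactGroup_def RCOSETS_def)
  obtain z' where z': "Poly_Mapping.keys z' \<subseteq> ?S" "t' = tensor_relations R M C #>\<^bsub>?F\<^esub> z'"
    using t' by (auto simp: tensor_def FactGroup_def RCOSETS_def)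
  define w where "w = z - z'"
  have w: "Poly_Mapping.keys w \<subseteq> ?S"
    using z z' keys_diff[of z z'] by (auto simp: w_def)
  have cM: "comm_group (add_monoid M)" by (rule M.a_comm_group)
  have ev: "frag_eval (add_monoid M) (\<lambda>(m, c). m \<triangleleft>\<^bsub>M\<^esub> \<kappa> a c) w = \<zero>\<^bsub>M\<^esub>" if a: "a \<in> carrier A" for a
  proof -
    note b = balanced_alpha[OF M a]
    have h: "frag_eval (add_monoid M) (\<lambda>(m, c). m \<triangleleft>\<^bsub>M\<^esub> \<kappa> a c) \<in> hom ?F (add_monoid M)"
      by (rule comm_group.frag_eval_hom[OF cM]) (use b in \<open>auto simp: balanced_map_def\<close>)
    have "frag_eval (add_monoid M) (\<lambda>(m, c). m \<triangleleft>\<^bsub>M\<^esub> \<kappa> a c) z =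
        frag_eval (add_monoid M) (\<lambda>(m, c). m \<triangleleft>\<^bsub>M\<^esub> \<kappa> a c) z'"
      using fun_cong[OF eq, of a] a
      by (simp add: alpha_map_def z z' tensor_lift_coset[OF M C cM b])
    from hom_diff_eq_one[OF cM h z(1) z'(1) this] show ?thesis
      by (simp add: w_def)
  qed
  have "finite (fst ` Poly_Mapping.keys w)" "fst ` Poly_Mapping.keys w \<subseteq> carrier M"
    using w by auto
  then obtain S and g :: "'m \<Rightarrow> (nat \<Rightarrow> 'r) set"
    where S: "right_submodule S R M" and wS: "fst ` Poly_Mapping.keys w \<subseteq> S" and g: "inj_on g S"
    using M.fin_gen_submodule by metis
  interpret S: right_submodule S R M by fact
  have SM: "S \<subseteq> carrier M" using S.subset by simp
  let ?M' = "transport_module M S g"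
  let ?h = "inv_into S g"
  have M': "right_module R ?M'" by (rule right_module_transport[OF M S g])
  interpret M': right_module R ?M' by fact
  have cM': "comm_group (add_monoid ?M')" by (rule M'.a_comm_group)
  have hg: "?h (g x) = x" if "x \<in> S" for x using g that by simp
  have carr: "carrier ?M' = g ` S" by (simp add: transport_module_def)
  have h_cl: "?h u \<in> carrier M" if "u \<in> carrier ?M'" for u
    using that SM by (auto simp: carr hg)
  have h_add: "?h (u \<oplus>\<^bsub>?M'\<^esub> v) = ?h u \<oplus>\<^bsub>M\<^esub> ?h v" if "u \<in> carrier ?M'" "v \<in> carrier ?M'" for u v
    using that S.m_closed by (auto simp: transport_module_def hg)
  have h_sm: "?h (u \<triangleleft>\<^bsub>?M'\<^esub> r) = ?h u \<triangleleft>\<^bsub>M\<^esub> r" if "u \<in> carrier ?M'" "r \<in> carrier R" for u r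
    using that S.rsmult_closed by (auto simp: transport_module_def hg)
  have h_inj: "u = v" if "?h u = ?h v" "u \<in> carrier ?M'" "v \<in> carrier ?M'" for u v
    using that by (auto simp: carr hg)
  let ?S' = "carrier ?M' \<times> carrier C"
  let ?F' = "free_Abelian_group ?S'"
  let ?SC = "S \<times> carrier C"
  have wSC: "Poly_Mapping.keys w \<subseteq> ?SC" using w wS by auto
  let ?push = "frag_extend (\<lambda>p. frag_of (g (fst p), snd p))"
  let ?pull = "frag_extend (\<lambda>p. frag_of (?h (fst p), snd p))"
  have push: "?push \<in> hom (free_Abelian_group ?SC) ?F'"
    by (rule frag_extend_hom) (auto simp: carr)
  define w' where "w' = ?push w"
  have w': "Poly_Mapping.keys w' \<subseteq> ?S'"
    using hom_in_carrier[OF push, of w] wSC by (simp add: w'_def)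
  have ev': "frag_eval (add_monoid ?M') (\<lambda>(m, c). m \<triangleleft>\<^bsub>?M'\<^esub> \<kappa> a c) w' = \<zero>\<^bsub>?M'\<^esub>"
    if a: "a \<in> carrier A" for a
  proof -
    let ?e = "frag_eval (add_monoid M) (\<lambda>(m, c). m \<triangleleft>\<^bsub>M\<^esub> \<kappa> a c)"
    let ?e' = "frag_eval (add_monoid ?M') (\<lambda>(m, c). m \<triangleleft>\<^bsub>?M'\<^esub> \<kappa> a c)"
    have kc: "\<kappa> a c \<in> carrier R" if "c \<in> carrier C" for c
      using kappa_hom a that
      by (auto simp: R_ring_hom_def bimodule_hom_def left_dual_def dest!: funcset_mem)
    have e: "?e \<in> hom (free_Abelian_group ?SC) (add_monoid M)"
      by (rule comm_group.frag_eval_hom[OF cM]) (use kc SM in auto)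
    have cl': "(\<lambda>(m, c). m \<triangleleft>\<^bsub>?M'\<^esub> \<kappa> a c) \<in> ?S' \<rightarrow> carrier (add_monoid ?M')"
      using kc M'.rsmult_closed by auto
    have e': "?e' \<in> hom ?F' (add_monoid ?M')"
      by (rule comm_group.frag_eval_hom[OF cM' cl'])
    have hh: "?h \<in> hom (add_monoid ?M') (add_monoid M)"
      by (auto simp: hom_def h_cl h_add)
    have comp: "?h \<circ> ?e' \<circ> ?push \<in> hom (free_Abelian_group ?SC) (add_monoid M)"
      using hom_compose[OF push hom_compose[OF e' hh]] by (simp add: comp_assoc)
    have "(?h \<circ> ?e' \<circ> ?push) w = ?e w"
    proof (rule free_Abelian_group_hom_eqI[OF _ comp e _ wSC])
      show "group (add_monoid M)" by (rule M.a_group)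
      fix p assume p: "p \<in> ?SC"
      then have gp: "g (fst p) \<in> carrier ?M'" by (auto simp: carr)
      have "?e' (frag_of (g (fst p), snd p)) = g (fst p) \<triangleleft>\<^bsub>?M'\<^esub> \<kappa> a (snd p)"
        using comm_group.frag_eval_frag_of[OF cM', of "\<lambda>(m, c). m \<triangleleft>\<^bsub>?M'\<^esub> \<kappa> a c" "(g (fst p), snd p)"]
          gp kc p by auto
      moreover have "?e (frag_of p) = fst p \<triangleleft>\<^bsub>M\<^esub> \<kappa> a (snd p)"
        using comm_group.frag_eval_frag_of[OF cM, of "\<lambda>(m, c). m \<triangleleft>\<^bsub>M\<^esub> \<kappa> a c" p] kc p SM by auto
      ultimately show "(?h \<circ> ?e' \<circ> ?push) (frag_of p) = ?e (frag_of p)"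
        using p kc[of "snd p"] h_sm[OF gp, of "\<kappa> a (snd p)"] by (auto simp: hg)
    qed
    then have "?h (?e' w') = \<zero>\<^bsub>M\<^esub>"
      using ev[OF a] by (simp add: w'_def)
    moreover have "?h \<zero>\<^bsub>?M'\<^esub> = \<zero>\<^bsub>M\<^esub>"
      using S.one_closed by (simp add: transport_module_def hg)
    moreover have "?e' w' \<in> carrier ?M'"
      using hom_in_carrier[OF e', of w'] w' by simp
    ultimately show ?thesis
      using h_inj[of "?e' w'" "\<zero>\<^bsub>?M'\<^esub>"] by simp
  qed
  have "alpha_map A \<kappa> ?M' (tensor_relations R ?M' C #>\<^bsub>?F'\<^esub> w') =
      alpha_map A \<kappa> ?M' (tensor_relations R ?M' C #>\<^bsub>?F'\<^esub> 0)"
    unfolding alpha_map_def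
  proof (rule restrict_ext)
    fix a assume a: "a \<in> carrier A"
    note b = balanced_alpha[OF M' a]
    show "tensor_lift (add_monoid ?M') (\<lambda>m c. m \<triangleleft>\<^bsub>?M'\<^esub> \<kappa> a c) (tensor_relations R ?M' C #>\<^bsub>?F'\<^esub> w') =
      tensor_lift (add_monoid ?M') (\<lambda>m c. m \<triangleleft>\<^bsub>?M'\<^esub> \<kappa> a c) (tensor_relations R ?M' C #>\<^bsub>?F'\<^esub> 0)"
      using ev'[OF a] w'
      by (simp add: tensor_lift_coset[OF M' C cM' b] comm_group.frag_eval_zero[OF cM'])
  qed
  moreover have "tensor_relations R ?M' C #>\<^bsub>?F'\<^esub> w' \<in> carrier (tensor R ?M' C)"
    "tensor_relations R ?M' C #>\<^bsub>?F'\<^esub> 0 \<in> carrier (tensor R ?M' C)"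
    using w' by (auto simp: tensor_def FactGroup_def RCOSETS_def)
  ultimately have "tensor_relations R ?M' C #>\<^bsub>?F'\<^esub> w' = tensor_relations R ?M' C #>\<^bsub>?F'\<^esub> 0"
    using alpha_inj[OF M'] by (meson inj_onD)
  then have "w' \<in> tensor_relations R ?M' C"
    using tensor_coset_eq_iff[OF M' C w', of 0] by simp
  then have "?pull w' \<in> tensor_relations R M C"
    by (intro tensor_relations_map[where \<phi> = ?h, OF M' M C]) (simp_all add: h_cl h_add h_sm)
  moreover have "?pull w' = w"
  proof -
    have "?pull (?push x) = x \<and> True" if "Poly_Mapping.keys x \<subseteq> ?SC" for x
      using that
      by (induction rule: frag_induction) (auto simp: frag_extend_diff hg)
    then show ?thesis using wSC by (simp add: w'_def)
  qed
  ultimately show "t = t'"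
    using tensor_coset_eq_iff[OF M C z(1) z'(1)] z(2) z'(2) by (simp add: w_def)
qed

end

(*
  A rational module M, and likewise the coring C with c.a = sum c_1 <a, c_2> (an A-action by
  coassociativity), is an A-module whose action is given by elements rho(m) of M (x) C. If K is an
  R-submodule of M and all values of alpha_M(t) lie in K, then t comes from K (x) C: its image in
  M/K (x) C is killed by the injective map alpha_{M/K}, and the tensor product is right exact.
  Applied to K = mA this writes rho(m) = sum m_i (x) c_i with m_i in mA, so that mA is generated by
  the m_i over R; hence the A-submodule N generated by a finite set is finitely generated over R.
  Applied to N, it shows that N is again rational, respectively that Delta(N) comes from N (x) C.
*)

theory Submission
  imports Defs
begin

subsection \<open>Tensor products\<close>

text \<open>If x is represented by a finite sum of m_i \<otimes> c_i, then every xa lies in the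
  R-module generated by the m_i. This does not make the orbit xA finitely generated: R need not be
  noetherian, so a submodule of a finitely generated module may need infinitely many generators. The
  m_i have to be replaced by elements of xA itself, and this is where injectivity of \<alpha>
  enters. Injectivity is used at the quotient M/K, whose elements are cosets. Its type differs from
  the one fixed in \<open>alpha_inj\<close>, so the argument rests on \<open>alpha_inj_all\<close>.
  K \<otimes> C and M \<otimes> C are quotients of different free groups, and the first is not a
  subset of the second. A tensor over K is therefore always related to one over M by
  \<open>tensor_map\<close> of the inclusion, and their \<alpha>-values are compared by
  naturality.\<close>

lemma tensor_comm_group:
  assumes M: "right_module R M" and N: "left_module R N"
  shows "comm_group (tensor R M N)"
  unfolding tensor_def
  by (rule comm_group.abelian_FactGroup[OF abelian_free_Abelian_group tensor_relations_subgroup[OF M N]])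

lemma tensor_coset_hom:
  assumes M: "right_module R M" and N: "left_module R N"
  shows "(\<lambda>z. tensor_relations R M N #>\<^bsub>free_Abelian_group (carrier M \<times> carrier N)\<^esub> z)
    \<in> hom (free_Abelian_group (carrier M \<times> carrier N)) (tensor R M N)"
  unfolding tensor_def
  by (rule normal.r_coset_hom_Mod, rule comm_group.normal_iff_subgroup[THEN iffD2])
    (rule abelian_free_Abelian_group tensor_relations_subgroup[OF M N])+

lemma tensor_cases:
  assumes "t \<in> carrier (tensor R M N)"
  obtains z where "Poly_Mapping.keys z \<subseteq> carrier M \<times> carrier N"
    "t = tensor_relations R M N #>\<^bsub>free_Abelian_group (carrier M \<times> carrier N)\<^esub> z"
  using assms by (auto simp: tensor_def FactGroup_def RCOSETS_def)

lemma tensor_coset_closed: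
  assumes "Poly_Mapping.keys z \<subseteq> carrier M \<times> carrier N"
  shows "tensor_relations R M N #>\<^bsub>free_Abelian_group (carrier M \<times> carrier N)\<^esub> z
    \<in> carrier (tensor R M N)"
  using assms by (auto simp: tensor_def FactGroup_def RCOSETS_def)

lemma pure_tensor_closed:
  assumes "x \<in> carrier M" "y \<in> carrier N"
  shows "pure_tensor R M N x y \<in> carrier (tensor R M N)"
  unfolding pure_tensor_def by (rule tensor_coset_closed) (use assms in simp)

lemma tensor_coset_add:
  assumes M: "right_module R M" and N: "left_module R N"
    and z: "Poly_Mapping.keys z \<subseteq> carrier M \<times> carrier N"
      "Poly_Mapping.keys z' \<subseteq> carrier M \<times> carrier N"
  shows "tensor_relations R M N #>\<^bsub>free_Abelian_group (carrier M \<times> carrier N)\<^esub> (z + z') =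
    (tensor_relations R M N #>\<^bsub>free_Abelian_group (carrier M \<times> carrier N)\<^esub> z) \<otimes>\<^bsub>tensor R M N\<^esub>
    (tensor_relations R M N #>\<^bsub>free_Abelian_group (carrier M \<times> carrier N)\<^esub> z')"
  using hom_mult[OF tensor_coset_hom[OF M N], of z z'] z by simp

lemma balanced_pure_tensor:
  assumes M: "right_module R M" and N: "left_module R N"
  shows "balanced_map R M N (tensor R M N) (pure_tensor R M N)"
proof -
  interpret M: right_module R M by fact
  interpret N: left_module R N by fact
  have k: "Poly_Mapping.keys (frag_of (x, y) + frag_of (x', y')) \<subseteq> carrier M \<times> carrier N"
    if "x \<in> carrier M" "y \<in> carrier N" "x' \<in> carrier M" "y' \<in> carrier N" for x y x' y'
    using that keys_add[of "frag_of (x, y)" "frag_of (x', y')"] by auto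
  have r: "z \<in> tensor_relations R M N" if "z \<in> tensor_generators R M N" for z
    unfolding tensor_relations_def by (rule generate.incl[OF that])
  \<comment> \<open>Each of the three laws is an equality of two cosets; the difference of the
    representatives is one of the generating relations.\<close>
  have 1: "pure_tensor R M N (x \<oplus>\<^bsub>M\<^esub> x') y =
      pure_tensor R M N x y \<otimes>\<^bsub>tensor R M N\<^esub> pure_tensor R M N x' y"
    if "x \<in> carrier M" "x' \<in> carrier M" "y \<in> carrier N" for x x' y
    unfolding pure_tensor_def using that
    apply (subst tensor_coset_add[OF M N, symmetric], simp, simp)
    apply (subst tensor_coset_eq_iff[OF M N], simp, simp add: k)
    apply (rule r, unfold tensor_generators_def, blast)
    done
  have 2: "pure_tensor R M N x (y \<oplus>\<^bsub>N\<^esub> y') =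
      pure_tensor R M N x y \<otimes>\<^bsub>tensor R M N\<^esub> pure_tensor R M N x y'"
    if "x \<in> carrier M" "y \<in> carrier N" "y' \<in> carrier N" for x y y'
    unfolding pure_tensor_def using that
    apply (subst tensor_coset_add[OF M N, symmetric], simp, simp)
    apply (subst tensor_coset_eq_iff[OF M N], simp, simp add: k)
    apply (rule r, unfold tensor_generators_def, blast)
    done
  have 3: "pure_tensor R M N (x \<triangleleft>\<^bsub>M\<^esub> s) y = pure_tensor R M N x (s \<triangleright>\<^bsub>N\<^esub> y)"
    if "x \<in> carrier M" "s \<in> carrier R" "y \<in> carrier N" for x s y
    unfolding pure_tensor_def using that
    apply (subst tensor_coset_eq_iff[OF M N], simp, simp)
    apply (rule r, unfold tensor_generators_def, blast)
    done
  show ?thesis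
    unfolding balanced_map_def using 1 2 3 by (simp add: pure_tensor_closed)
qed

lemma tensor_lift_hom:
  assumes M: "right_module R M" and N: "left_module R N" and G: "comm_group G"
    and \<beta>: "balanced_map R M N G \<beta>"
  shows "tensor_lift G \<beta> \<in> hom (tensor R M N) G"
proof -
  have b: "case_prod \<beta> \<in> carrier M \<times> carrier N \<rightarrow> carrier G"
    using \<beta> by (simp add: balanced_map_def Pi_iff)
  note h = comm_group.frag_eval_hom[OF G b]
  note l = tensor_lift_coset[OF M N G \<beta>]
  show ?thesis
  proof (rule homI)
    fix t assume "t \<in> carrier (tensor R M N)"
    then obtain z where z: "Poly_Mapping.keys z \<subseteq> carrier M \<times> carrier N"
      "t = tensor_relations R M N #>\<^bsub>free_Abelian_group (carrier M \<times> carrier N)\<^esub> z"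
      by (rule tensor_cases)
    show "tensor_lift G \<beta> t \<in> carrier G"
      unfolding z(2) l[OF z(1)] using hom_in_carrier[OF h, of z] z(1) by simp
    fix t' assume "t' \<in> carrier (tensor R M N)"
    then obtain z' where z': "Poly_Mapping.keys z' \<subseteq> carrier M \<times> carrier N"
      "t' = tensor_relations R M N #>\<^bsub>free_Abelian_group (carrier M \<times> carrier N)\<^esub> z'"
      by (rule tensor_cases)
    have k: "Poly_Mapping.keys (z + z') \<subseteq> carrier M \<times> carrier N"
      using z(1) z'(1) keys_add[of z z'] by blast
    show "tensor_lift G \<beta> (t \<otimes>\<^bsub>tensor R M N\<^esub> t') = tensor_lift G \<beta> t \<otimes>\<^bsub>G\<^esub> tensor_lift G \<beta> t'"
      unfolding z(2) z'(2) tensor_coset_add[OF M N z(1) z'(1), symmetric] l[OF k] l[OF z(1)] l[OF z'(1)]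
      using hom_mult[OF h, of z z'] z(1) z'(1) by simp
  qed
qed

text \<open>Pure tensors are the images of the free generators, so the claim descends from the free
  group. Almost every later identity about tensors is proved by this rule, once both sides are
  exhibited as homomorphisms in the tensor.\<close>

lemma tensor_hom_eqI:
  assumes M: "right_module R M" and N: "left_module R N" and G: "group G"
    and h: "h \<in> hom (tensor R M N) G" and k: "k \<in> hom (tensor R M N) G"
    and eq: "\<And>x y. \<lbrakk>x \<in> carrier M; y \<in> carrier N\<rbrakk> \<Longrightarrow>
      h (pure_tensor R M N x y) = k (pure_tensor R M N x y)"
    and t: "t \<in> carrier (tensor R M N)"
  shows "h t = k t"
  using t
proof (cases rule: tensor_cases)
  case (1 z)
  let ?q = "\<lambda>z. tensor_relations R M N #>\<^bsub>free_Abelian_group (carrier M \<times> carrier N)\<^esub> z"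
  have "(h \<circ> ?q) z = (k \<circ> ?q) z"
  proof (rule free_Abelian_group_hom_eqI[OF G])
    show "h \<circ> ?q \<in> hom (free_Abelian_group (carrier M \<times> carrier N)) G"
      by (rule hom_compose[OF tensor_coset_hom[OF M N] h])
    show "k \<circ> ?q \<in> hom (free_Abelian_group (carrier M \<times> carrier N)) G"
      by (rule hom_compose[OF tensor_coset_hom[OF M N] k])
    fix p assume "p \<in> carrier M \<times> carrier N"
    then show "(h \<circ> ?q) (frag_of p) = (k \<circ> ?q) (frag_of p)"
      using eq[of "fst p" "snd p"] by (simp add: pure_tensor_def mem_Times_iff)
  qed (rule 1(1))
  then show ?thesis
    unfolding 1(2) comp_def .
qed

text \<open>Presents sums such as t r + t s as homomorphisms in t, so that
  \<open>tensor_hom_eqI\<close> applies to distributive laws. Commutativity of G is what makes the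
  product a homomorphism.\<close>

lemma hom_mult_pointwise:
  assumes "comm_group G" "h \<in> hom H G" "k \<in> hom H G"
  shows "(\<lambda>x. h x \<otimes>\<^bsub>G\<^esub> k x) \<in> hom H G"
proof -
  interpret G: comm_group G by fact
  show ?thesis
    using assms(2,3) by (auto simp: hom_def Pi_iff G.m_ac)
qed

text \<open>One-sided linearity, in contrast to \<open>bimodule_hom\<close>: a map on the left
  tensor factor has to respect right scalars, a map on the right factor left scalars. Submodules and
  quotients of M carry only the right structure.\<close>

definition linear_map ::
    "('r, 'z) ring_scheme \<Rightarrow> ('r, 'm, 'v) rmodule_scheme \<Rightarrow> ('r, 'n, 'w) rmodule_scheme
      \<Rightarrow> ('m \<Rightarrow> 'n) \<Rightarrow> bool"
  where "linear_map R M N f \<longleftrightarrow> f \<in> carrier M \<rightarrow> carrier N \<and>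
      (\<forall>x\<in>carrier M. \<forall>y\<in>carrier M. f (x \<oplus>\<^bsub>M\<^esub> y) = f x \<oplus>\<^bsub>N\<^esub> f y) \<and>
      (\<forall>x\<in>carrier M. \<forall>r\<in>carrier R. f (x \<triangleleft>\<^bsub>M\<^esub> r) = f x \<triangleleft>\<^bsub>N\<^esub> r)"

definition left_linear_map ::
    "('r, 'z) ring_scheme \<Rightarrow> ('r, 'm, 'v) bimodule_scheme \<Rightarrow> ('r, 'n, 'w) bimodule_scheme
      \<Rightarrow> ('m \<Rightarrow> 'n) \<Rightarrow> bool"
  where "left_linear_map R M N f \<longleftrightarrow> f \<in> carrier M \<rightarrow> carrier N \<and>
      (\<forall>x\<in>carrier M. \<forall>y\<in>carrier M. f (x \<oplus>\<^bsub>M\<^esub> y) = f x \<oplus>\<^bsub>N\<^esub> f y) \<and>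
      (\<forall>r\<in>carrier R. \<forall>x\<in>carrier M. f (r \<triangleright>\<^bsub>M\<^esub> x) = r \<triangleright>\<^bsub>N\<^esub> f x)"

lemma balanced_map_comp:
  assumes "balanced_map R M' N' G \<beta>" "linear_map R M M' f" "left_linear_map R N N' g"
  shows "balanced_map R M N G (\<lambda>x y. \<beta> (f x) (g y))"
  using assms unfolding balanced_map_def linear_map_def left_linear_map_def
  by (simp add: Pi_iff)

lemma tensor_map_hom:
  assumes M: "right_module R M" and N: "left_module R N"
    and M': "right_module R M'" and N': "left_module R N'"
    and f: "linear_map R M M' f" and g: "left_linear_map R N N' g"
  shows "tensor_map R M' N' f g \<in> hom (tensor R M N) (tensor R M' N')"
  unfolding tensor_map_def
  by (rule tensor_lift_hom[OF M N tensor_comm_group[OF M' N']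
      balanced_map_comp[OF balanced_pure_tensor[OF M' N'] f g]])

lemma tensor_map_pure:
  assumes M: "right_module R M" and N: "left_module R N"
    and M': "right_module R M'" and N': "left_module R N'"
    and f: "linear_map R M M' f" and g: "left_linear_map R N N' g"
    and xy: "x \<in> carrier M" "y \<in> carrier N"
  shows "tensor_map R M' N' f g (pure_tensor R M N x y) = pure_tensor R M' N' (f x) (g y)"
  unfolding tensor_map_def
  by (rule tensor_lift_pure[OF M N tensor_comm_group[OF M' N']
      balanced_map_comp[OF balanced_pure_tensor[OF M' N'] f g] xy])

lemma linear_map_id: "linear_map R M M (\<lambda>x. x)"
  by (simp add: linear_map_def)

lemma left_linear_map_id: "left_linear_map R N N (\<lambda>x. x)"
  by (simp add: left_linear_map_def)

lemma (in bimodule) linear_map_lsmult: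
  "r \<in> carrier R \<Longrightarrow> linear_map R M M (\<lambda>x. r \<triangleright>\<^bsub>M\<^esub> x)"
  by (simp add: linear_map_def lsmult_r_distr lsmult_rsmult)

lemma (in bimodule) left_linear_map_rsmult:
  "r \<in> carrier R \<Longrightarrow> left_linear_map R M M (\<lambda>x. x \<triangleleft>\<^bsub>M\<^esub> r)"
  by (simp add: left_linear_map_def rsmult_l_distr lsmult_rsmult)

section \<open>The bimodule structure on a tensor product\<close>

lemma carrier_tensor_bimodule [simp]: "carrier (tensor_bimodule R M N) = carrier (tensor R M N)"
  and add_tensor_bimodule [simp]: "x \<oplus>\<^bsub>tensor_bimodule R M N\<^esub> y = x \<otimes>\<^bsub>tensor R M N\<^esub> y"
  and zero_tensor_bimodule [simp]: "\<zero>\<^bsub>tensor_bimodule R M N\<^esub> = \<one>\<^bsub>tensor R M N\<^esub>"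
  by (simp_all add: tensor_bimodule_def)

lemma tensor_bimodule_smult_pure:
  assumes M: "bimodule R M" and N: "bimodule R N"
    and r: "r \<in> carrier R" and xy: "x \<in> carrier M" "y \<in> carrier N"
  shows "pure_tensor R M N x y \<triangleleft>\<^bsub>tensor_bimodule R M N\<^esub> r = pure_tensor R M N x (y \<triangleleft>\<^bsub>N\<^esub> r)"
    and "r \<triangleright>\<^bsub>tensor_bimodule R M N\<^esub> pure_tensor R M N x y = pure_tensor R M N (r \<triangleright>\<^bsub>M\<^esub> x) y"
proof -
  interpret M: bimodule R M by fact
  interpret N: bimodule R N by fact
  note i = M.right_module_axioms N.left_module_axioms
  show "pure_tensor R M N x y \<triangleleft>\<^bsub>tensor_bimodule R M N\<^esub> r = pure_tensor R M N x (y \<triangleleft>\<^bsub>N\<^esub> r)"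
    using tensor_map_pure[OF i i linear_map_id N.left_linear_map_rsmult[OF r] xy]
    by (simp add: tensor_bimodule_def)
  show "r \<triangleright>\<^bsub>tensor_bimodule R M N\<^esub> pure_tensor R M N x y = pure_tensor R M N (r \<triangleright>\<^bsub>M\<^esub> x) y"
    using tensor_map_pure[OF i i M.linear_map_lsmult[OF r] left_linear_map_id xy]
    by (simp add: tensor_bimodule_def)
qed

lemma tensor_bimodule_smult_hom:
  assumes M: "bimodule R M" and N: "bimodule R N" and r: "r \<in> carrier R"
  shows "(\<lambda>t. t \<triangleleft>\<^bsub>tensor_bimodule R M N\<^esub> r) \<in> hom (tensor R M N) (tensor R M N)"
    and "(\<lambda>t. r \<triangleright>\<^bsub>tensor_bimodule R M N\<^esub> t) \<in> hom (tensor R M N) (tensor R M N)"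
proof -
  interpret M: bimodule R M by fact
  interpret N: bimodule R N by fact
  note i = M.right_module_axioms N.left_module_axioms
  show "(\<lambda>t. t \<triangleleft>\<^bsub>tensor_bimodule R M N\<^esub> r) \<in> hom (tensor R M N) (tensor R M N)"
    using tensor_map_hom[OF i i linear_map_id N.left_linear_map_rsmult[OF r]]
    by (simp add: tensor_bimodule_def)
  show "(\<lambda>t. r \<triangleright>\<^bsub>tensor_bimodule R M N\<^esub> t) \<in> hom (tensor R M N) (tensor R M N)"
    using tensor_map_hom[OF i i M.linear_map_lsmult[OF r] left_linear_map_id]
    by (simp add: tensor_bimodule_def)
qed

text \<open>For fixed scalars, both sides of each law numbered 1 to 7 are homomorphisms in the
  tensor, so the law reduces to pure tensors and there to the factors. Coassociativity needs this
  structure, since it tensors C with C \<otimes> C.\<close>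

lemma bimodule_tensor_bimodule:
  assumes M: "bimodule R M" and N: "bimodule R N"
  shows "bimodule R (tensor_bimodule R M N)"
proof -
  interpret M: bimodule R M by fact
  interpret N: bimodule R N by fact
  let ?T = "tensor_bimodule R M N"
  let ?G = "tensor R M N"
  note i = M.right_module_axioms N.left_module_axioms
  interpret T: comm_group ?G by (rule tensor_comm_group[OF i])
  have ab: "abelian_group ?T"
    by (rule abelian_groupI) (auto simp: T.m_ac intro!: bexI[OF _ T.inv_closed])
  note p = tensor_bimodule_smult_pure[OF M N]
  note h = tensor_bimodule_smult_hom[OF M N]
  note b = balanced_pure_tensor[OF i, unfolded balanced_map_def]
  note e = tensor_hom_eqI[OF i T.is_group]
  note hm = hom_mult_pointwise[OF T.comm_group_axioms]
  have c: "t \<triangleleft>\<^bsub>?T\<^esub> r \<in> carrier ?G" "r \<triangleright>\<^bsub>?T\<^esub> t \<in> carrier ?G"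
    if "t \<in> carrier ?G" "r \<in> carrier R" for t r
    using hom_in_carrier[OF h(1)] hom_in_carrier[OF h(2)] that by auto
  have idh: "(\<lambda>t. t) \<in> hom ?G ?G" by (simp add: hom_def)
  have 1: "t \<triangleleft>\<^bsub>?T\<^esub> (r \<oplus>\<^bsub>R\<^esub> s) = (t \<triangleleft>\<^bsub>?T\<^esub> r) \<otimes>\<^bsub>?G\<^esub> (t \<triangleleft>\<^bsub>?T\<^esub> s)"
    if "t \<in> carrier ?G" "r \<in> carrier R" "s \<in> carrier R" for t r s
    by (rule e[OF h(1) hm[OF h(1) h(1)] _ that(1)]) (use that b in \<open>simp_all add: p N.rsmult_r_distr\<close>)
  have 2: "(r \<oplus>\<^bsub>R\<^esub> s) \<triangleright>\<^bsub>?T\<^esub> t = (r \<triangleright>\<^bsub>?T\<^esub> t) \<otimes>\<^bsub>?G\<^esub> (s \<triangleright>\<^bsub>?T\<^esub> t)"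
    if "t \<in> carrier ?G" "r \<in> carrier R" "s \<in> carrier R" for t r s
    by (rule e[OF h(2) hm[OF h(2) h(2)] _ that(1)]) (use that b in \<open>simp_all add: p M.lsmult_l_distr\<close>)
  have 3: "t \<triangleleft>\<^bsub>?T\<^esub> (r \<otimes>\<^bsub>R\<^esub> s) = (t \<triangleleft>\<^bsub>?T\<^esub> r) \<triangleleft>\<^bsub>?T\<^esub> s"
    if "t \<in> carrier ?G" "r \<in> carrier R" "s \<in> carrier R" for t r s
    by (rule e[OF h(1) hom_compose[OF h(1) h(1), unfolded comp_def] _ that(1)])
      (use that in \<open>simp_all add: p N.rsmult_assoc\<close>)
  have 4: "(r \<otimes>\<^bsub>R\<^esub> s) \<triangleright>\<^bsub>?T\<^esub> t = r \<triangleright>\<^bsub>?T\<^esub> (s \<triangleright>\<^bsub>?T\<^esub> t)"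
    if "t \<in> carrier ?G" "r \<in> carrier R" "s \<in> carrier R" for t r s
    by (rule e[OF h(2) hom_compose[OF h(2) h(2), unfolded comp_def] _ that(1)])
      (use that in \<open>simp_all add: p M.lsmult_assoc\<close>)
  have 5: "t \<triangleleft>\<^bsub>?T\<^esub> \<one>\<^bsub>R\<^esub> = t" if "t \<in> carrier ?G" for t
    by (rule e[OF h(1) idh _ that(1)]) (simp_all add: p)
  have 6: "\<one>\<^bsub>R\<^esub> \<triangleright>\<^bsub>?T\<^esub> t = t" if "t \<in> carrier ?G" for t
    by (rule e[OF h(2) idh _ that(1)]) (simp_all add: p)
  have 7: "(r \<triangleright>\<^bsub>?T\<^esub> t) \<triangleleft>\<^bsub>?T\<^esub> s = r \<triangleright>\<^bsub>?T\<^esub> (t \<triangleleft>\<^bsub>?T\<^esub> s)"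
    if "t \<in> carrier ?G" "r \<in> carrier R" "s \<in> carrier R" for t r s
    by (rule e[OF hom_compose[OF h(2) h(1), unfolded comp_def] hom_compose[OF h(1) h(2), unfolded comp_def] _ that(1)])
      (use that in \<open>simp_all add: p\<close>)
  have "right_module R ?T"
    by (intro right_module.intro right_module_axioms.intro ab M.R.ring_axioms)
      (simp_all add: c 1 3 5 hom_mult[OF h(1)])
  moreover have "left_module R ?T"
    by (intro left_module.intro left_module_axioms.intro ab M.R.ring_axioms)
      (simp_all add: c 2 4 6 hom_mult[OF h(2)])
  ultimately show ?thesis
    by (intro bimodule.intro bimodule_axioms.intro) (simp_all add: 7)
qed


subsection \<open>Submodules and quotients\<close>

lemma right_module_submodule:
  assumes M: "right_module R M" and K: "right_submodule K R M"
  shows "right_module R (M\<lparr>carrier := K\<rparr>)"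
proof -
  interpret M: right_module R M by fact
  interpret K: right_submodule K R M by fact
  have KM: "x \<in> carrier M" if "x \<in> K" for x
    using K.subset that by auto
  have "abelian_group (M\<lparr>carrier := K\<rparr>)"
  proof (rule abelian_groupI)
    fix x assume "x \<in> carrier (M\<lparr>carrier := K\<rparr>)"
    then show "\<exists>y\<in>carrier (M\<lparr>carrier := K\<rparr>). y \<oplus>\<^bsub>M\<lparr>carrier := K\<rparr>\<^esub> x = \<zero>\<^bsub>M\<lparr>carrier := K\<rparr>\<^esub>"
      using K.m_inv_closed[of x] M.l_neg[of x] KM
      by (intro bexI[of _ "\<ominus>\<^bsub>M\<^esub> x"]) (simp_all add: a_inv_def)
  qed (use K.m_closed K.one_closed in \<open>simp_all add: KM M.a_ac\<close>)
  then show ?thesis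
    by (intro right_module.intro right_module_axioms.intro M.R.ring_axioms)
      (simp_all add: KM M.rsmult_l_distr M.rsmult_r_distr M.rsmult_assoc)
qed

lemma right_submodule_trans:
  assumes M: "right_module R M" and K: "right_submodule K R M"
    and H: "right_submodule H R (M\<lparr>carrier := K\<rparr>)"
  shows "right_submodule H R M"
proof -
  interpret M: right_module R M by fact
  interpret K: right_submodule K R M by fact
  interpret H: right_submodule H R "M\<lparr>carrier := K\<rparr>" by fact
  have "subgroup H (add_monoid M)"
    using group.incl_subgroup[OF M.a_group K.subgroup_axioms, of H] H.subgroup_axioms by simp
  then show ?thesis
    using H.rsmult_closed by (simp add: right_submodule_def right_submodule_axioms_def)
qed

lemma right_submodule_restrict:
  assumes M: "right_module R M" and K: "right_submodule K R M"
    and H: "right_submodule H R M" and HK: "H \<subseteq> K"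
  shows "right_submodule H R (M\<lparr>carrier := K\<rparr>)"
proof -
  interpret M: right_module R M by fact
  interpret K: right_submodule K R M by fact
  interpret H: right_submodule H R M by fact
  have "subgroup H ((add_monoid M)\<lparr>carrier := K\<rparr>)"
    by (rule group.subgroup_incl[OF M.a_group H.subgroup_axioms K.subgroup_axioms HK])
  then show ?thesis
    using H.rsmult_closed by (simp add: right_submodule_def right_submodule_axioms_def)
qed

lemma right_submodule_carrier:
  assumes "right_module R M" shows "right_submodule (carrier M) R M"
proof -
  interpret right_module R M by fact
  show ?thesis
    using M.add.subgroup_self by (simp add: right_submodule_def right_submodule_axioms_def)
qed

lemma right_submodule_Inter:
  assumes M: "right_module R M" and A: "A \<noteq> {}" and H: "\<And>H. H \<in> A \<Longrightarrow> right_submodule H R M"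
  shows "right_submodule (\<Inter>A) R M"
proof -
  interpret right_module R M by fact
  show ?thesis
  proof (intro right_submodule.intro right_submodule_axioms.intro)
    show "subgroup (\<Inter>A) (add_monoid M)"
      using H by (intro M.add.subgroups_Inter A) (simp add: right_submodule_def)
  qed (use H in \<open>auto intro: right_submodule.rsmult_closed\<close>)
qed

lemma right_submodule_right_span:
  assumes M: "right_module R M" and Y: "Y \<subseteq> carrier M"
  shows "right_submodule (right_span R M Y) R M"
  unfolding right_span_def
  by (rule right_submodule_Inter[OF M]) (use right_submodule_carrier[OF M] Y in auto)

lemma right_span_superset: "Y \<subseteq> right_span R M Y"
  by (auto simp: right_span_def)

lemma right_span_minimal:
  assumes "right_submodule H R M" "Y \<subseteq> H"
  shows "right_span R M Y \<subseteq> H"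
  using assms by (auto simp: right_span_def)

text \<open>Generation must hold inside the span, viewed as a module of its own. A submodule of the
  span that contains Y is also a submodule of M containing Y, hence is the whole span.\<close>

lemma right_fin_gen_right_span:
  assumes M: "right_module R M" and Y: "finite Y" "Y \<subseteq> carrier M"
  shows "right_fin_gen R (M\<lparr>carrier := right_span R M Y\<rparr>)"
proof -
  let ?N = "right_span R M Y"
  have sN: "right_submodule ?N R M"
    by (rule right_submodule_right_span[OF M Y(2)])
  have N: "right_module R (M\<lparr>carrier := ?N\<rparr>)"
    by (rule right_module_submodule[OF M sN])
  have Y': "Y \<subseteq> carrier (M\<lparr>carrier := ?N\<rparr>)"
    using right_span_superset[of Y R M] by simp
  have "right_submodule (right_span R (M\<lparr>carrier := ?N\<rparr>) Y) R M"
    by (rule right_submodule_trans[OF M sN right_submodule_right_span[OF N Y']])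
  then have "?N \<subseteq> right_span R (M\<lparr>carrier := ?N\<rparr>) Y"
    by (rule right_span_minimal[OF _ right_span_superset])
  moreover have "right_span R (M\<lparr>carrier := ?N\<rparr>) Y \<subseteq> ?N"
    using right_span_minimal[OF right_submodule_carrier[OF N] Y'] by simp
  ultimately show ?thesis
    unfolding right_fin_gen_def using Y(1) Y' by (intro exI[of _ Y]) auto
qed

text \<open>M/K as a transport along the coset map. That map is not injective in general, so the
  operations act on representatives chosen by \<open>inv_into\<close>, and the module laws depend on
  independence of this choice rather than on \<open>right_module_transport\<close>.\<close>

abbreviation quotient_module ::
    "('r, 'm, 'w) rmodule_scheme \<Rightarrow> 'm set \<Rightarrow> ('r, 'm set) rmodule"
  where "quotient_module M K \<equiv> transport_module M (carrier M) (\<lambda>x. a_r_coset M K x)"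

context right_module
begin

lemma rsmult_minus:
  assumes "x \<in> carrier M" "r \<in> carrier R"
  shows "(\<ominus>\<^bsub>M\<^esub> x) \<triangleleft>\<^bsub>M\<^esub> r = \<ominus>\<^bsub>M\<^esub> (x \<triangleleft>\<^bsub>M\<^esub> r)"
proof -
  have "\<zero>\<^bsub>M\<^esub> \<triangleleft>\<^bsub>M\<^esub> r \<oplus>\<^bsub>M\<^esub> \<zero>\<^bsub>M\<^esub> \<triangleleft>\<^bsub>M\<^esub> r = \<zero>\<^bsub>M\<^esub> \<triangleleft>\<^bsub>M\<^esub> r"
    using rsmult_l_distr[of "\<zero>\<^bsub>M\<^esub>" "\<zero>\<^bsub>M\<^esub>" r] assms by simp
  then have "\<zero>\<^bsub>M\<^esub> \<triangleleft>\<^bsub>M\<^esub> r = \<zero>\<^bsub>M\<^esub>"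
    using assms by (metis M.add.r_cancel_one' M.zero_closed rsmult_closed)
  then have "(\<ominus>\<^bsub>M\<^esub> x) \<triangleleft>\<^bsub>M\<^esub> r \<oplus>\<^bsub>M\<^esub> x \<triangleleft>\<^bsub>M\<^esub> r = \<zero>\<^bsub>M\<^esub>"
    using assms rsmult_l_distr[of "\<ominus>\<^bsub>M\<^esub> x" x r] by (simp add: M.l_neg)
  then show ?thesis
    using assms M.minus_equality by simp
qed

context
  fixes K assumes K: "right_submodule K R M"
begin

interpretation K: right_submodule K R M by (rule K)

lemma submodule_in_carrier: "x \<in> K \<Longrightarrow> x \<in> carrier M"
  using K.subset by auto

lemma a_coset_eq_iff:
  assumes "x \<in> carrier M" "y \<in> carrier M"
  shows "K +>\<^bsub>M\<^esub> x = K +>\<^bsub>M\<^esub> y \<longleftrightarrow> x \<ominus>\<^bsub>M\<^esub> y \<in> K"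
proof
  assume "K +>\<^bsub>M\<^esub> x = K +>\<^bsub>M\<^esub> y"
  moreover have "x \<in> K +>\<^bsub>M\<^esub> x"
    using M.add.rcos_self[OF assms(1) K.subgroup_axioms] by (simp add: a_r_coset_def)
  ultimately obtain k where k: "k \<in> K" "x = k \<oplus>\<^bsub>M\<^esub> y"
    by (auto simp: a_r_coset_def r_coset_def)
  then have "x \<ominus>\<^bsub>M\<^esub> y = k"
    using assms submodule_in_carrier[OF k(1)] by (simp add: M.minus_eq M.a_assoc M.r_neg)
  with k show "x \<ominus>\<^bsub>M\<^esub> y \<in> K" by simp
next
  assume k: "x \<ominus>\<^bsub>M\<^esub> y \<in> K"
  have "x = (x \<ominus>\<^bsub>M\<^esub> y) \<oplus>\<^bsub>M\<^esub> y"
    using assms by (simp add: M.minus_eq M.a_assoc M.l_neg)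
  then have "x \<in> K +>\<^bsub>M\<^esub> y"
    using k by (auto simp: a_r_coset_def r_coset_def)
  then show "K +>\<^bsub>M\<^esub> x = K +>\<^bsub>M\<^esub> y"
    using M.add.repr_independence[OF _ assms(2) K.subgroup_axioms, of x] by (simp add: a_r_coset_def)
qed

private abbreviation (input) "q \<equiv> \<lambda>x. K +>\<^bsub>M\<^esub> x"
private abbreviation (input) "s \<equiv> inv_into (carrier M) (\<lambda>x. K +>\<^bsub>M\<^esub> x)"

text \<open>The chosen representative of the coset of x is only congruent to x modulo K, and the
  choice respects neither addition nor scalars. All computations in the quotient go through this
  congruence.\<close>

lemma quotient_section:
  assumes "x \<in> carrier M"
  shows "s (q x) \<in> carrier M" "q (s (q x)) = q x" "s (q x) \<ominus>\<^bsub>M\<^esub> x \<in> K"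
proof -
  show 1: "s (q x) \<in> carrier M"
    by (rule inv_into_into) (use assms in simp)
  show 2: "q (s (q x)) = q x"
    by (rule f_inv_into_f) (use assms in simp)
  show "s (q x) \<ominus>\<^bsub>M\<^esub> x \<in> K"
    using a_coset_eq_iff[OF 1 assms] 2 by simp
qed

lemma a_coset_add_cong:
  assumes "q x = q x'" "q y = q y'" "x \<in> carrier M" "x' \<in> carrier M" "y \<in> carrier M" "y' \<in> carrier M"
  shows "q (x \<oplus>\<^bsub>M\<^esub> y) = q (x' \<oplus>\<^bsub>M\<^esub> y')"
proof -
  have "(x \<oplus>\<^bsub>M\<^esub> y) \<ominus>\<^bsub>M\<^esub> (x' \<oplus>\<^bsub>M\<^esub> y') = (x \<ominus>\<^bsub>M\<^esub> x') \<oplus>\<^bsub>M\<^esub> (y \<ominus>\<^bsub>M\<^esub> y')"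
    using assms(3-) by (simp add: M.minus_eq M.minus_add M.a_ac)
  moreover have "(x \<ominus>\<^bsub>M\<^esub> x') \<oplus>\<^bsub>M\<^esub> (y \<ominus>\<^bsub>M\<^esub> y') \<in> K"
    using assms a_coset_eq_iff K.m_closed by simp
  ultimately show ?thesis
    using assms(3-) a_coset_eq_iff by simp
qed

lemma a_coset_rsmult_cong:
  assumes "q x = q x'" "x \<in> carrier M" "x' \<in> carrier M" "r \<in> carrier R"
  shows "q (x \<triangleleft>\<^bsub>M\<^esub> r) = q (x' \<triangleleft>\<^bsub>M\<^esub> r)"
proof -
  have "(x \<ominus>\<^bsub>M\<^esub> x') \<triangleleft>\<^bsub>M\<^esub> r \<in> K"
    using assms a_coset_eq_iff by (intro K.rsmult_closed) simp_all
  moreover have "(x \<ominus>\<^bsub>M\<^esub> x') \<triangleleft>\<^bsub>M\<^esub> r = x \<triangleleft>\<^bsub>M\<^esub> r \<ominus>\<^bsub>M\<^esub> x' \<triangleleft>\<^bsub>M\<^esub> r"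
    using assms by (simp add: M.minus_eq rsmult_l_distr rsmult_minus)
  ultimately show ?thesis
    using assms by (simp add: a_coset_eq_iff)
qed

lemma quotient_add:
  assumes "x \<in> carrier M" "y \<in> carrier M"
  shows "q x \<oplus>\<^bsub>quotient_module M K\<^esub> q y = q (x \<oplus>\<^bsub>M\<^esub> y)"
  using assms quotient_section by (simp add: transport_module_def) (rule a_coset_add_cong; simp)

lemma quotient_rsmult:
  assumes "x \<in> carrier M" "r \<in> carrier R"
  shows "q x \<triangleleft>\<^bsub>quotient_module M K\<^esub> r = q (x \<triangleleft>\<^bsub>M\<^esub> r)"
  using assms quotient_section by (simp add: transport_module_def) (rule a_coset_rsmult_cong; simp)

lemma carrier_quotient: "carrier (quotient_module M K) = q ` carrier M"
  and zero_quotient: "\<zero>\<^bsub>quotient_module M K\<^esub> = q \<zero>\<^bsub>M\<^esub>"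
  by (simp_all add: transport_module_def)

lemma right_module_quotient: "right_module R (quotient_module M K)"
proof -
  have "abelian_group (quotient_module M K)"
  proof (rule abelian_groupI)
    fix u assume "u \<in> carrier (quotient_module M K)"
    then obtain x where "x \<in> carrier M" "u = q x" by (auto simp: carrier_quotient)
    then show "\<exists>v\<in>carrier (quotient_module M K). v \<oplus>\<^bsub>quotient_module M K\<^esub> u = \<zero>\<^bsub>quotient_module M K\<^esub>"
      by (intro bexI[of _ "q (\<ominus>\<^bsub>M\<^esub> x)"]) (simp_all add: carrier_quotient quotient_add zero_quotient M.l_neg)
  qed (auto simp: carrier_quotient zero_quotient quotient_add M.a_ac)
  then show ?thesis
    by (intro right_module.intro right_module_axioms.intro R.ring_axioms)
      (auto simp: carrier_quotient quotient_add quotient_rsmult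
        rsmult_l_distr rsmult_r_distr rsmult_assoc)
qed

end

end


section \<open>Inclusions, projections and right exactness of the tensor product\<close>

lemma linear_map_inclusion:
  assumes "right_submodule K R M"
  shows "linear_map R (M\<lparr>carrier := K\<rparr>) M (\<lambda>x. x)"
proof -
  interpret right_submodule K R M by fact
  show ?thesis
    using subset by (auto simp: linear_map_def)
qed

lemma (in right_module) linear_map_quotient:
  assumes "right_submodule K R M"
  shows "linear_map R M (quotient_module M K) (\<lambda>x. K +>\<^bsub>M\<^esub> x)"
  using assms by (simp add: linear_map_def carrier_quotient quotient_add quotient_rsmult)

lemma balanced_map_hom:
  assumes "balanced_map R M N G \<beta>" "h \<in> hom G H"
  shows "balanced_map R M N H (\<lambda>x y. h (\<beta> x y))"
  using assms(1) hom_in_carrier[OF assms(2)] hom_mult[OF assms(2)]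
  by (simp add: balanced_map_def)

text \<open>
  Right exactness of the tensor product. With \<open>I\<close> the image of \<open>K \<otimes> N\<close>, a section of \<open>M \<rightarrow> M/K\<close>
  induces a homomorphism \<open>M/K \<otimes> N \<rightarrow> (M \<otimes> N)/I\<close> through which \<open>M \<otimes> N \<rightarrow> (M \<otimes> N)/I\<close> factors.
\<close>

lemma tensor_map_quotient_kernel:
  assumes M: "right_module R M" and N: "left_module R N" and K: "right_submodule K R M"
    and t: "t \<in> carrier (tensor R M N)"
    and t0: "tensor_map R (quotient_module M K) N (\<lambda>x. K +>\<^bsub>M\<^esub> x) (\<lambda>y. y) t =
      \<one>\<^bsub>tensor R (quotient_module M K) N\<^esub>"
  shows "t \<in> tensor_map R M N (\<lambda>x. x) (\<lambda>y. y) ` carrier (tensor R (M\<lparr>carrier := K\<rparr>) N)"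
proof -
  interpret M: right_module R M by fact
  interpret K: right_submodule K R M by fact
  let ?Q = "quotient_module M K"
  let ?K = "M\<lparr>carrier := K\<rparr>"
  let ?T = "tensor R M N"
  have Q: "right_module R ?Q" by (rule M.right_module_quotient[OF K])
  have K': "right_module R ?K" by (rule right_module_submodule[OF M K])
  interpret T: comm_group ?T by (rule tensor_comm_group[OF M N])
  interpret TQ: comm_group "tensor R ?Q N" by (rule tensor_comm_group[OF Q N])
  interpret TK: comm_group "tensor R ?K N" by (rule tensor_comm_group[OF K' N])
  let ?i = "tensor_map R M N (\<lambda>x. x) (\<lambda>y. y)"
  note i = linear_map_inclusion[OF K] left_linear_map_id[of R N]
  have ih: "?i \<in> hom (tensor R ?K N) ?T"
    by (rule tensor_map_hom[OF K' N M N i])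
  define I where "I = ?i ` carrier (tensor R ?K N)"
  have I: "subgroup I ?T"
    unfolding I_def using ih
    by (intro group_hom.img_is_subgroup)
      (simp add: group_hom_def group_hom_axioms_def TK.is_group T.is_group)
  let ?G = "?T Mod I"
  interpret G: comm_group ?G by (rule T.abelian_FactGroup[OF I])
  let ?p = "\<lambda>t. I #>\<^bsub>?T\<^esub> t"
  have ph: "?p \<in> hom ?T ?G"
    using I by (intro normal.r_coset_hom_Mod) (simp add: T.normal_iff_subgroup)
  define c where "c x y = ?p (pure_tensor R M N x y)" for x y
  have c: "balanced_map R M N ?G c"
    unfolding c_def by (rule balanced_map_hom[OF balanced_pure_tensor[OF M N] ph])
  have cc: "c x y \<in> carrier ?G" if "x \<in> carrier M" "y \<in> carrier N" for x y
    using c that by (simp add: balanced_map_def)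
  \<comment> \<open>Here k \<otimes> y is the image of a pure tensor over K, so it lies in
    I.\<close>
  have cK: "c k y = \<one>\<^bsub>?G\<^esub>" if "k \<in> K" "y \<in> carrier N" for k y
  proof -
    have "pure_tensor R ?K N k y \<in> carrier (tensor R ?K N)"
      by (rule pure_tensor_closed) (use that in simp_all)
    moreover have "?i (pure_tensor R ?K N k y) = pure_tensor R M N k y"
      by (rule tensor_map_pure[OF K' N M N i]) (use that in simp_all)
    ultimately have "pure_tensor R M N k y \<in> I"
      unfolding I_def by (metis imageI)
    then show ?thesis
      unfolding c_def using T.coset_join2[OF _ I] subgroup.mem_carrier[OF I] by simp
  qed
  have cq: "c x y = c x' y"
    if "K +>\<^bsub>M\<^esub> x = K +>\<^bsub>M\<^esub> x'" "x \<in> carrier M" "x' \<in> carrier M" "y \<in> carrier N" for x x' y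
  proof -
    have k: "x \<ominus>\<^bsub>M\<^esub> x' \<in> K"
      using M.a_coset_eq_iff[OF K] that by simp
    have "x = (x \<ominus>\<^bsub>M\<^esub> x') \<oplus>\<^bsub>M\<^esub> x'"
      using that by (simp add: M.minus_eq M.M.a_assoc M.M.l_neg)
    then have "c x y = c (x \<ominus>\<^bsub>M\<^esub> x') y \<otimes>\<^bsub>?G\<^esub> c x' y"
      using c that unfolding balanced_map_def by (metis M.M.minus_closed)
    then show ?thesis
      unfolding cK[OF k that(4)] using G.l_one[OF cc[OF that(3,4)]] by (rule trans)
  qed
  define s where "s = inv_into (carrier M) (\<lambda>x. K +>\<^bsub>M\<^esub> x)"
  note sq = M.quotient_section[OF K, folded s_def]
  \<comment> \<open>The section s is in general neither additive nor R-linear. Since c is constant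
    on the cosets of K, \<beta> nevertheless inherits balancedness from c.\<close>
  define \<beta> where "\<beta> u y = c (s u) y" for u y
  have \<beta>q: "\<beta> (K +>\<^bsub>M\<^esub> x) y = c x y" if "x \<in> carrier M" "y \<in> carrier N" for x y
    unfolding \<beta>_def by (rule cq) (use sq that in simp_all)
  have \<beta>: "balanced_map R ?Q N ?G \<beta>"
    using c cc unfolding balanced_map_def
    by (simp add: M.carrier_quotient[OF K] M.quotient_add[OF K] M.quotient_rsmult[OF K] \<beta>q
        left_module.lsmult_closed[OF N] abelian_monoid.a_closed[OF abelian_group.axioms(1)[OF left_module.axioms(2)[OF N]]])
  let ?m = "tensor_map R ?Q N (\<lambda>x. K +>\<^bsub>M\<^esub> x) (\<lambda>y. y)"
  note q = M.linear_map_quotient[OF K] left_linear_map_id[of R N]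
  have qc: "K +>\<^bsub>M\<^esub> x \<in> carrier ?Q" if "x \<in> carrier M" for x
    using that by (simp add: M.carrier_quotient[OF K])
  have lh: "tensor_lift ?G \<beta> \<in> hom (tensor R ?Q N) ?G"
    by (rule tensor_lift_hom[OF Q N G.comm_group_axioms \<beta>])
  have "(tensor_lift ?G \<beta> \<circ> ?m) t = ?p t"
  proof (rule tensor_hom_eqI[OF M N G.is_group _ ph _ t])
    show "tensor_lift ?G \<beta> \<circ> ?m \<in> hom ?T ?G"
      by (rule hom_compose[OF tensor_map_hom[OF M N Q N q] lh])
    fix x y assume xy: "x \<in> carrier M" "y \<in> carrier N"
    then show "(tensor_lift ?G \<beta> \<circ> ?m) (pure_tensor R M N x y) = ?p (pure_tensor R M N x y)"
      by (simp add: tensor_map_pure[OF M N Q N q] tensor_lift_pure[OF Q N G.comm_group_axioms \<beta>] qc \<beta>q c_def)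
  qed
  then have "?p t = \<one>\<^bsub>?G\<^esub>"
    using t0 hom_one[OF lh TQ.is_group G.is_group] by simp
  then have "?p t = I"
    by (simp add: FactGroup_def)
  then have "t \<in> I"
    using T.rcos_self[OF t I] by simp
  then show ?thesis
    by (simp add: I_def)
qed

subsection \<open>The map \<open>\<alpha>\<close>\<close>

context measuring_left_pairing
begin

lemma kappa_closed:
  assumes "a \<in> carrier A" "c \<in> carrier C"
  shows "\<kappa> a c \<in> carrier R"
proof -
  have "\<kappa> a \<in> carrier (left_dual R C)"
    using kappa_hom assms by (auto simp: R_ring_hom_def bimodule_hom_def)
  then show ?thesis
    using assms by (auto simp: left_dual_def)
qed

lemma alpha_map_hom:
  assumes M: "right_module R M" and a: "a \<in> carrier A"
  shows "(\<lambda>t. alpha_map A \<kappa> M t a) \<in> hom (tensor R M C) (add_monoid M)"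
proof -
  interpret M: right_module R M by fact
  show ?thesis
    using tensor_lift_hom[OF M C.left_module_axioms M.a_comm_group balanced_alpha[OF M a]] a
    by (simp add: alpha_map_def)
qed

lemma alpha_map_pure:
  assumes M: "right_module R M" and a: "a \<in> carrier A" and x: "x \<in> carrier M" "c \<in> carrier C"
  shows "alpha_map A \<kappa> M (pure_tensor R M C x c) a = x \<triangleleft>\<^bsub>M\<^esub> \<kappa> a c"
proof -
  interpret M: right_module R M by fact
  show ?thesis
    using tensor_lift_pure[OF M C.left_module_axioms M.a_comm_group balanced_alpha[OF M a] x] a
    by (simp add: alpha_map_def)
qed

text \<open>On m \<otimes> c both sides are f(m) \<langle>a, c\<rangle>, by right linearity of f. It
  is applied to the inclusion of K and to the projection onto M/K.\<close>

lemma alpha_map_natural: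
  assumes M: "right_module R M" and M': "right_module R M'" and f: "linear_map R M M' f"
    and a: "a \<in> carrier A" and t: "t \<in> carrier (tensor R M C)"
  shows "alpha_map A \<kappa> M' (tensor_map R M' C f (\<lambda>c. c) t) a = f (alpha_map A \<kappa> M t a)"
proof -
  interpret M': right_module R M' by fact
  note N = C.left_module_axioms
  note f' = f left_linear_map_id[of R C]
  have fh: "f \<in> hom (add_monoid M) (add_monoid M')"
    using f by (simp add: linear_map_def hom_def)
  have "((\<lambda>t. alpha_map A \<kappa> M' t a) \<circ> tensor_map R M' C f (\<lambda>c. c)) t = (f \<circ> (\<lambda>t. alpha_map A \<kappa> M t a)) t"
  proof (rule tensor_hom_eqI[OF M N M'.a_group _ _ _ t])
    show "(\<lambda>t. alpha_map A \<kappa> M' t a) \<circ> tensor_map R M' C f (\<lambda>c. c) \<in> hom (tensor R M C) (add_monoid M')"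
      by (rule hom_compose[OF tensor_map_hom[OF M N M' N f'] alpha_map_hom[OF M' a]])
    show "f \<circ> (\<lambda>t. alpha_map A \<kappa> M t a) \<in> hom (tensor R M C) (add_monoid M')"
      by (rule hom_compose[OF alpha_map_hom[OF M a] fh])
    fix x c assume "x \<in> carrier M" "c \<in> carrier C"
    then show "((\<lambda>t. alpha_map A \<kappa> M' t a) \<circ> tensor_map R M' C f (\<lambda>c. c)) (pure_tensor R M C x c) =
        (f \<circ> (\<lambda>t. alpha_map A \<kappa> M t a)) (pure_tensor R M C x c)"
      using f a kappa_closed[OF a]
      by (simp add: tensor_map_pure[OF M N M' N f'] alpha_map_pure[OF M] alpha_map_pure[OF M']
          linear_map_def Pi_iff)
  qed
  then show ?thesis by simp
qed

text \<open>A representing formal sum has finitely many first components, and they do not depend on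
  a; only the coefficients \<langle>a, c\<rangle> do. Hence one finite Y serves all a.\<close>

lemma alpha_map_fin_gen:
  assumes M: "right_module R M" and t: "t \<in> carrier (tensor R M C)"
  shows "\<exists>Y. finite Y \<and> Y \<subseteq> carrier M \<and>
    (\<forall>a\<in>carrier A. \<forall>H. right_submodule H R M \<and> Y \<subseteq> H \<longrightarrow> alpha_map A \<kappa> M t a \<in> H)"
proof -
  interpret M: right_module R M by fact
  note N = C.left_module_axioms
  from t obtain z where z: "Poly_Mapping.keys z \<subseteq> carrier M \<times> carrier C"
    "t = tensor_relations R M C #>\<^bsub>free_Abelian_group (carrier M \<times> carrier C)\<^esub> z"
    by (rule tensor_cases)
  let ?Y = "fst ` Poly_Mapping.keys z"
  have "alpha_map A \<kappa> M t a \<in> H"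
    if a: "a \<in> carrier A" and H: "right_submodule H R M" and YH: "?Y \<subseteq> H" for a H
  proof -
    let ?H = "M\<lparr>carrier := H\<rparr>"
    have HM: "right_module R ?H" by (rule right_module_submodule[OF M H])
    interpret HM: right_module R ?H by (rule HM)
    note i = linear_map_inclusion[OF H] left_linear_map_id[of R C]
    let ?h = "\<lambda>z. tensor_relations R ?H C #>\<^bsub>free_Abelian_group (carrier ?H \<times> carrier C)\<^esub> z"
    have z': "Poly_Mapping.keys z \<subseteq> carrier ?H \<times> carrier C"
      using z(1) YH by auto
    \<comment> \<open>The same formal sum z is read over H and over M. The two readings are
      homomorphisms on the free group over H and agree on its generators.\<close>
    have "(tensor_map R M C (\<lambda>x. x) (\<lambda>c. c) \<circ> ?h) z =
      tensor_relations R M C #>\<^bsub>free_Abelian_group (carrier M \<times> carrier C)\<^esub> z"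
    proof (rule free_Abelian_group_hom_eqI[OF _ _ _ _ z'])
      show "Group.group (tensor R M C)"
        using tensor_comm_group[OF M N] by (rule comm_group.axioms(2))
      show "tensor_map R M C (\<lambda>x. x) (\<lambda>c. c) \<circ> ?h
          \<in> hom (free_Abelian_group (carrier ?H \<times> carrier C)) (tensor R M C)"
        by (rule hom_compose[OF tensor_coset_hom[OF HM N] tensor_map_hom[OF HM N M N i]])
      have kM: "Poly_Mapping.keys x \<subseteq> carrier M \<times> carrier C"
        if "Poly_Mapping.keys x \<subseteq> carrier ?H \<times> carrier C" for x
        using that M.submodule_in_carrier[OF H] by auto
      show "(\<lambda>z. tensor_relations R M C #>\<^bsub>free_Abelian_group (carrier M \<times> carrier C)\<^esub> z)
          \<in> hom (free_Abelian_group (carrier ?H \<times> carrier C)) (tensor R M C)"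
        by (rule homI) (simp_all only: carrier_free_Abelian_group_iff kM
            mult_free_Abelian_group tensor_coset_closed tensor_coset_add[OF M N])
      fix p assume p: "p \<in> carrier ?H \<times> carrier C"
      then show "(tensor_map R M C (\<lambda>x. x) (\<lambda>c. c) \<circ> ?h) (frag_of p) =
          tensor_relations R M C #>\<^bsub>free_Abelian_group (carrier M \<times> carrier C)\<^esub> frag_of p"
        using tensor_map_pure[OF HM N M N i, of "fst p" "snd p"]
        by (simp add: pure_tensor_def mem_Times_iff)
    qed
    then have "t = tensor_map R M C (\<lambda>x. x) (\<lambda>c. c) (?h z)"
      using z(2) by simp
    then have "alpha_map A \<kappa> M t a = alpha_map A \<kappa> ?H (?h z) a"
      using alpha_map_natural[OF HM M i(1) a tensor_coset_closed[OF z']] by simp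
    moreover have "alpha_map A \<kappa> ?H (?h z) a \<in> carrier (add_monoid ?H)"
      by (rule hom_in_carrier[OF alpha_map_hom[OF HM a] tensor_coset_closed[OF z']])
    ultimately show ?thesis by simp
  qed
  moreover have "finite ?Y" "?Y \<subseteq> carrier M"
    using z(1) by auto
  ultimately show ?thesis by blast
qed

end

text \<open>By naturality, \<alpha> of the image of t in M/K \<otimes> C is the projection of
  \<alpha>(t), which vanishes. Injectivity is invoked for a module on the type
  \<open>'m set\<close>, through \<open>alpha_inj_all\<close>.\<close>

theorem (in measuring_left_alpha_pairing) alpha_in_submodule:
  fixes M :: "('r, 'm, 'u) rmodule_scheme"
  assumes M: "right_module R M" and K: "right_submodule K R M"
    and t: "t \<in> carrier (tensor R M C)"
    and tK: "\<And>a. a \<in> carrier A \<Longrightarrow> alpha_map A \<kappa> M t a \<in> K"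
  shows "t \<in> tensor_map R M C (\<lambda>x. x) (\<lambda>c. c) ` carrier (tensor R (M\<lparr>carrier := K\<rparr>) C)"
proof (rule tensor_map_quotient_kernel[OF M C.left_module_axioms K t])
  interpret M: right_module R M by fact
  let ?Q = "quotient_module M K"
  let ?m = "tensor_map R ?Q C (\<lambda>x. K +>\<^bsub>M\<^esub> x) (\<lambda>c. c)"
  note N = C.left_module_axioms
  have Q: "right_module R ?Q" by (rule M.right_module_quotient[OF K])
  interpret Q: right_module R ?Q by (rule Q)
  interpret TQ: comm_group "tensor R ?Q C" by (rule tensor_comm_group[OF Q N])
  note q = M.linear_map_quotient[OF K]
  have mt: "?m t \<in> carrier (tensor R ?Q C)"
    using tensor_map_hom[OF M N Q N q left_linear_map_id] t by (rule hom_in_carrier)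
  have "alpha_map A \<kappa> ?Q (?m t) = alpha_map A \<kappa> ?Q \<one>\<^bsub>tensor R ?Q C\<^esub>"
  proof (rule extensionalityI[of _ "carrier A"])
    fix a assume a: "a \<in> carrier A"
    have "alpha_map A \<kappa> ?Q (?m t) a = K +>\<^bsub>M\<^esub> alpha_map A \<kappa> M t a"
      by (rule alpha_map_natural[OF M Q q a t])
    also have "\<dots> = \<zero>\<^bsub>?Q\<^esub>"
      unfolding M.zero_quotient[OF K]
      using tK[OF a] M.submodule_in_carrier[OF K tK[OF a]]
      by (simp add: M.a_coset_eq_iff[OF K] M.minus_eq a_inv_def)
    also have "\<dots> = alpha_map A \<kappa> ?Q \<one>\<^bsub>tensor R ?Q C\<^esub> a"
      using hom_one[OF alpha_map_hom[OF Q a] TQ.is_group Q.a_group] by simp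
    finally show "alpha_map A \<kappa> ?Q (?m t) a = alpha_map A \<kappa> ?Q \<one>\<^bsub>tensor R ?Q C\<^esub> a" .
  qed (simp_all add: alpha_map_def)
  then show "?m t = \<one>\<^bsub>tensor R ?Q C\<^esub>"
    using alpha_inj_all[OF Q] mt by (auto dest: inj_onD)
qed


subsection \<open>Rational actions\<close>

context measuring_left_pairing
begin

lemma kappa_add: "\<lbrakk>a \<in> carrier A; b \<in> carrier A; c \<in> carrier C\<rbrakk> \<Longrightarrow> \<kappa> (a \<oplus>\<^bsub>A\<^esub> b) c = \<kappa> a c \<oplus>\<^bsub>R\<^esub> \<kappa> b c"
  and kappa_rsmult: "\<lbrakk>a \<in> carrier A; r \<in> carrier R; c \<in> carrier C\<rbrakk> \<Longrightarrow> \<kappa> (a \<triangleleft>\<^bsub>A\<^esub> r) c = \<kappa> a c \<otimes>\<^bsub>R\<^esub> r"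
  and kappa_lsmult: "\<lbrakk>a \<in> carrier A; r \<in> carrier R; c \<in> carrier C\<rbrakk> \<Longrightarrow> \<kappa> (r \<triangleright>\<^bsub>A\<^esub> a) c = \<kappa> a (c \<triangleleft>\<^bsub>C\<^esub> r)"
  and kappa_one: "c \<in> carrier C \<Longrightarrow> \<kappa> \<one>\<^bsub>A\<^esub> c = counit C c"
  and kappa_mult: "\<lbrakk>a \<in> carrier A; b \<in> carrier A; c \<in> carrier C\<rbrakk> \<Longrightarrow> \<kappa> (a \<otimes>\<^bsub>A\<^esub> b) c =
    tensor_lift (add_monoid R) (\<lambda>c1 c2. \<kappa> b (c1 \<triangleleft>\<^bsub>C\<^esub> \<kappa> a c2)) (comult C c)"
  using kappa_hom
  by (simp_all add: R_ring_hom_def ring_hom_def bimodule_hom_def left_dual_def)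

lemma kappa_linear:
  assumes "a \<in> carrier A" "c \<in> carrier C"
  shows "d \<in> carrier C \<Longrightarrow> \<kappa> a (c \<oplus>\<^bsub>C\<^esub> d) = \<kappa> a c \<oplus>\<^bsub>R\<^esub> \<kappa> a d"
    and "r \<in> carrier R \<Longrightarrow> \<kappa> a (r \<triangleright>\<^bsub>C\<^esub> c) = r \<otimes>\<^bsub>R\<^esub> \<kappa> a c"
proof -
  have "\<kappa> a \<in> carrier (left_dual R C)"
    using kappa_hom assms by (auto simp: R_ring_hom_def bimodule_hom_def)
  then show "d \<in> carrier C \<Longrightarrow> \<kappa> a (c \<oplus>\<^bsub>C\<^esub> d) = \<kappa> a c \<oplus>\<^bsub>R\<^esub> \<kappa> a d"
    and "r \<in> carrier R \<Longrightarrow> \<kappa> a (r \<triangleright>\<^bsub>C\<^esub> c) = r \<otimes>\<^bsub>R\<^esub> \<kappa> a c"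
    using assms by (simp_all add: left_dual_def)
qed

text \<open>With the next lemma: \<alpha>(t) is right R-linear in a because \<kappa> is. This turns
  the orbits of a rational action into right R-submodules.\<close>

lemma alpha_map_add:
  assumes M: "right_module R M" and t: "t \<in> carrier (tensor R M C)"
    and a: "a \<in> carrier A" "b \<in> carrier A"
  shows "alpha_map A \<kappa> M t (a \<oplus>\<^bsub>A\<^esub> b) = alpha_map A \<kappa> M t a \<oplus>\<^bsub>M\<^esub> alpha_map A \<kappa> M t b"
proof -
  interpret M: right_module R M by fact
  have ab: "a \<oplus>\<^bsub>A\<^esub> b \<in> carrier A" using a by simp
  have "alpha_map A \<kappa> M t (a \<oplus>\<^bsub>A\<^esub> b) =
      alpha_map A \<kappa> M t a \<otimes>\<^bsub>add_monoid M\<^esub> alpha_map A \<kappa> M t b"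
    by (rule tensor_hom_eqI[OF M C.left_module_axioms M.a_group alpha_map_hom[OF M ab]
          hom_mult_pointwise[OF M.a_comm_group alpha_map_hom[OF M a(1)] alpha_map_hom[OF M a(2)]] _ t])
      (use a in \<open>simp add: alpha_map_pure[OF M] kappa_add kappa_closed M.rsmult_r_distr\<close>)
  then show ?thesis by simp
qed

lemma alpha_map_rsmult:
  assumes M: "right_module R M" and t: "t \<in> carrier (tensor R M C)"
    and a: "a \<in> carrier A" and r: "r \<in> carrier R"
  shows "alpha_map A \<kappa> M t (a \<triangleleft>\<^bsub>A\<^esub> r) = alpha_map A \<kappa> M t a \<triangleleft>\<^bsub>M\<^esub> r"
proof -
  interpret M: right_module R M by fact
  have ar: "a \<triangleleft>\<^bsub>A\<^esub> r \<in> carrier A" using a r by simp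
  have rh: "(\<lambda>x. x \<triangleleft>\<^bsub>M\<^esub> r) \<in> hom (add_monoid M) (add_monoid M)"
    using r by (auto simp: hom_def M.rsmult_l_distr)
  show ?thesis
    by (rule tensor_hom_eqI[OF M C.left_module_axioms M.a_group alpha_map_hom[OF M ar]
          hom_compose[OF alpha_map_hom[OF M a] rh, unfolded comp_def] _ t])
      (use a r in \<open>simp add: alpha_map_pure[OF M] kappa_rsmult kappa_closed M.rsmult_assoc\<close>)
qed

lemma alpha_map_closed:
  assumes M: "right_module R M" and t: "t \<in> carrier (tensor R M C)" and a: "a \<in> carrier A"
  shows "alpha_map A \<kappa> M t a \<in> carrier M"
  using hom_in_carrier[OF alpha_map_hom[OF M a] t] by simp

end

text \<open>The maps x \<mapsto> xa are additive but not right R-linear: (xr)a = x(ra), so a scalar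
  changes the index. The condition \<open>sm\<close> therefore refers to all indices at
  once.\<close>

lemma (in right_module) right_submodule_preimage:
  assumes H: "right_submodule H R M"
    and f: "\<And>i. i \<in> I \<Longrightarrow> f i \<in> hom (add_monoid M) (add_monoid M)"
    and sm: "\<And>i x r. \<lbrakk>i \<in> I; x \<in> carrier M; r \<in> carrier R; \<forall>j\<in>I. f j x \<in> H\<rbrakk> \<Longrightarrow> f i (x \<triangleleft>\<^bsub>M\<^esub> r) \<in> H"
  shows "right_submodule {x \<in> carrier M. \<forall>i\<in>I. f i x \<in> H} R M"
proof (intro right_submodule.intro right_submodule_axioms.intro)
  interpret H: right_submodule H R M by fact
  have gh: "group_hom (add_monoid M) (add_monoid M) (f i)" if "i \<in> I" for i
    using f[OF that] by (simp add: group_hom_def group_hom_axioms_def M.a_group)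
  show "subgroup {x \<in> carrier M. \<forall>i\<in>I. f i x \<in> H} (add_monoid M)"
  proof (rule M.add.subgroupI)
    have "f i \<zero>\<^bsub>M\<^esub> \<in> H" if "i \<in> I" for i
      using group_hom.hom_one[OF gh[OF that]] H.one_closed by simp
    then show "{x \<in> carrier M. \<forall>i\<in>I. f i x \<in> H} \<noteq> {}"
      using M.zero_closed by blast
  next
    fix x assume x: "x \<in> {x \<in> carrier M. \<forall>i\<in>I. f i x \<in> H}"
    have "f i (\<ominus>\<^bsub>M\<^esub> x) \<in> H" if "i \<in> I" for i
      using group_hom.hom_inv[OF gh[OF that], of x] H.m_inv_closed[of "f i x"] x that
      by (simp add: a_inv_def)
    with x show "\<ominus>\<^bsub>M\<^esub> x \<in> {x \<in> carrier M. \<forall>i\<in>I. f i x \<in> H}" by simp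
  next
    fix x y
    assume "x \<in> {x \<in> carrier M. \<forall>i\<in>I. f i x \<in> H}" "y \<in> {x \<in> carrier M. \<forall>i\<in>I. f i x \<in> H}"
    then show "x \<oplus>\<^bsub>M\<^esub> y \<in> {x \<in> carrier M. \<forall>i\<in>I. f i x \<in> H}"
      using hom_mult[OF f] H.m_closed by simp
  qed auto
qed (use sm in auto)

text \<open>
  Both parts of the theorem are instances: for a rational \<open>\<A>\<close>-module \<open>act\<close> is its action, for the
  coring it is \<open>c \<mapsto> \<Sum> c\<^sub>1 \<langle>a, c\<^sub>2\<rangle>\<close>. The orbit of \<open>x\<close> is finitely generated because, by
  \<open>alpha_in_submodule\<close>, the tensor representing \<open>x\<close> already lives over the orbit.
\<close>

theorem (in measuring_left_alpha_pairing) rational_action_fin_gen: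
  fixes M :: "('r, 'm, 'u) rmodule_scheme"
  assumes M: "right_module R M"
    and rational: "\<And>x. x \<in> carrier M \<Longrightarrow>
      \<exists>t\<in>carrier (tensor R M C). \<forall>a\<in>carrier A. act x a = alpha_map A \<kappa> M t a"
    and add: "\<And>x y a. \<lbrakk>x \<in> carrier M; y \<in> carrier M; a \<in> carrier A\<rbrakk> \<Longrightarrow>
      act (x \<oplus>\<^bsub>M\<^esub> y) a = act x a \<oplus>\<^bsub>M\<^esub> act y a"
    and rsmult: "\<And>x r a. \<lbrakk>x \<in> carrier M; r \<in> carrier R; a \<in> carrier A\<rbrakk> \<Longrightarrow>
      act (x \<triangleleft>\<^bsub>M\<^esub> r) a = act x (r \<triangleright>\<^bsub>A\<^esub> a)"
    and one: "\<And>x. x \<in> carrier M \<Longrightarrow> act x \<one>\<^bsub>A\<^esub> = x"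
    and mult: "\<And>x a b. \<lbrakk>x \<in> carrier M; a \<in> carrier A; b \<in> carrier A\<rbrakk> \<Longrightarrow>
      act x (a \<otimes>\<^bsub>A\<^esub> b) = act (act x a) b"
    and F: "finite F" "F \<subseteq> carrier M"
  obtains Y where "finite Y" "Y \<subseteq> carrier M" "F \<subseteq> right_span R M Y"
    "\<And>x a. \<lbrakk>x \<in> right_span R M Y; a \<in> carrier A\<rbrakk> \<Longrightarrow> act x a \<in> right_span R M Y"
proof -
  interpret M: right_module R M by fact
  have closed: "act x a \<in> carrier M" if "x \<in> carrier M" "a \<in> carrier A" for x a
    using rational[OF that(1)] alpha_map_closed[OF M _ that(2)] that(2) by auto
  have act_hom: "(\<lambda>x. act x a) \<in> hom (add_monoid M) (add_monoid M)" if "a \<in> carrier A" for a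
    using that closed add by (auto simp: hom_def)
  \<comment> \<open>Linearity in a comes from rationality: on x the action is \<alpha>(t) for a
    single tensor t.\<close>
  have act_add: "act x (a \<oplus>\<^bsub>A\<^esub> b) = act x a \<oplus>\<^bsub>M\<^esub> act x b"
    and act_rsmult: "r \<in> carrier R \<Longrightarrow> act x (a \<triangleleft>\<^bsub>A\<^esub> r) = act x a \<triangleleft>\<^bsub>M\<^esub> r"
    if "x \<in> carrier M" "a \<in> carrier A" "b \<in> carrier A" for x a b r
    using rational[OF that(1)] that alpha_map_add[OF M] alpha_map_rsmult[OF M] by auto
  have orbit: "right_submodule (act x ` carrier A) R M" if x: "x \<in> carrier M" for x
  proof (intro right_submodule.intro right_submodule_axioms.intro)
    have "act x \<in> hom (add_monoid A) (add_monoid M)"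
      using x by (auto simp: hom_def closed act_add)
    then have "group_hom (add_monoid A) (add_monoid M) (act x)"
      by (simp add: group_hom_def group_hom_axioms_def M.a_group A.M.a_group)
    from group_hom.img_is_subgroup[OF this] show "subgroup (act x ` carrier A) (add_monoid M)"
      by simp
    fix y r assume "y \<in> act x ` carrier A" "r \<in> carrier R"
    then obtain a where "a \<in> carrier A" "y = act x a" by blast
    then have "y \<triangleleft>\<^bsub>M\<^esub> r = act x (a \<triangleleft>\<^bsub>A\<^esub> r)" "a \<triangleleft>\<^bsub>A\<^esub> r \<in> carrier A"
      using x \<open>r \<in> carrier R\<close> act_rsmult by auto
    then show "y \<triangleleft>\<^bsub>M\<^esub> r \<in> act x ` carrier A" by blast
  qed
  have orbit_fin_gen: "\<exists>Y. finite Y \<and> Y \<subseteq> act x ` carrier A \<and> act x ` carrier A \<subseteq> right_span R M Y"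
    if x: "x \<in> carrier M" for x
  proof -
    let ?K = "act x ` carrier A"
    let ?MK = "M\<lparr>carrier := ?K\<rparr>"
    note K = orbit[OF x]
    have MK: "right_module R ?MK" by (rule right_module_submodule[OF M K])
    obtain t where t: "t \<in> carrier (tensor R M C)" "\<forall>a\<in>carrier A. act x a = alpha_map A \<kappa> M t a"
      using rational[OF x] by blast
    have "t \<in> tensor_map R M C (\<lambda>x. x) (\<lambda>c. c) ` carrier (tensor R ?MK C)"
      using t(2) by (intro alpha_in_submodule[OF M K t(1)]) auto
    then obtain s where s: "s \<in> carrier (tensor R ?MK C)"
        "t = tensor_map R M C (\<lambda>x. x) (\<lambda>c. c) s"
      by blast
    have act: "act x a = alpha_map A \<kappa> ?MK s a" if "a \<in> carrier A" for a
      using alpha_map_natural[OF MK M linear_map_inclusion[OF K] that s(1)] t(2) that s(2) by simp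
    obtain Y where Y: "finite Y" "Y \<subseteq> carrier ?MK"
      and YH: "\<And>a H. \<lbrakk>a \<in> carrier A; right_submodule H R ?MK; Y \<subseteq> H\<rbrakk> \<Longrightarrow> alpha_map A \<kappa> ?MK s a \<in> H"
      using alpha_map_fin_gen[OF MK s(1)] by blast
    have YM: "Y \<subseteq> carrier M"
      using Y(2) M.submodule_in_carrier[OF K] by auto
    have YK: "Y \<subseteq> ?K"
      using Y(2) by simp
    note span = right_submodule_right_span[OF M YM]
    \<comment> \<open>The bound \<open>YH\<close> concerns submodules of the orbit. The span,
      although formed in M, is one of them because Y lies in the orbit.\<close>
    have "right_submodule (right_span R M Y) R ?MK"
      by (rule right_submodule_restrict[OF M K span right_span_minimal[OF K YK]])
    then have "?K \<subseteq> right_span R M Y"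
      using YH[OF _ _ right_span_superset] act by auto
    with Y(1) YK show ?thesis by blast
  qed
  obtain G where G: "\<And>x. x \<in> carrier M \<Longrightarrow> finite (G x)"
    "\<And>x. x \<in> carrier M \<Longrightarrow> G x \<subseteq> act x ` carrier A"
    "\<And>x. x \<in> carrier M \<Longrightarrow> act x ` carrier A \<subseteq> right_span R M (G x)"
    using orbit_fin_gen by metis
  \<comment> \<open>The generators are taken from the orbits of the elements of F. F itself lies in
    their span because each x is the action of the unit on x.\<close>
  define Y where "Y = (\<Union>x\<in>F. G x)"
  define N where "N = right_span R M Y"
  have Y: "finite Y" "Y \<subseteq> carrier M"
  proof -
    show "finite Y"
      unfolding Y_def using F G(1) by blast
    show "Y \<subseteq> carrier M"
    proof
      fix y assume "y \<in> Y"
      then obtain x where "x \<in> F" "y \<in> G x" unfolding Y_def by blast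
      moreover from this have "x \<in> carrier M" using F(2) by blast
      ultimately obtain a where "a \<in> carrier A" "y = act x a" using G(2)[of x] by blast
      then show "y \<in> carrier M" using closed \<open>x \<in> carrier M\<close> by simp
    qed
  qed
  have N: "right_submodule N R M"
    unfolding N_def by (rule right_submodule_right_span[OF M Y(2)])
  have orbN: "act x a \<in> N" if "x \<in> F" "a \<in> carrier A" for x a
  proof -
    have "G x \<subseteq> N"
      using that right_span_superset[of Y R M] by (auto simp: N_def Y_def)
    then have "right_span R M (G x) \<subseteq> N"
      by (rule right_span_minimal[OF N])
    then show ?thesis
      using G(3)[of x] that F(2) by blast
  qed
  have "F \<subseteq> N"
  proof
    fix x assume "x \<in> F"
    then show "x \<in> N" using orbN[of x "\<one>\<^bsub>A\<^esub>"] one[of x] F(2) by auto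
  qed
  \<comment> \<open>The elements whose whole orbit lies in N form a submodule, so stability of N has
    to be checked only on the generators in Y.\<close>
  have sub: "right_submodule {x \<in> carrier M. \<forall>a\<in>carrier A. act x a \<in> N} R M"
    by (rule M.right_submodule_preimage[OF N act_hom]) (simp_all add: rsmult)
  have "Y \<subseteq> {x \<in> carrier M. \<forall>a\<in>carrier A. act x a \<in> N}"
  proof
    fix y assume y: "y \<in> Y"
    then obtain x a where x: "x \<in> F" "x \<in> carrier M" "a \<in> carrier A" "y = act x a"
      using F(2) G(2) unfolding Y_def by blast
    \<comment> \<open>Since y = xa with x in F, associativity gives yb = x(ab), again in the orbit
      of x.\<close>
    have "act y b \<in> N" if "b \<in> carrier A" for b
      using mult[OF x(2,3) that] orbN[OF x(1), of "a \<otimes>\<^bsub>A\<^esub> b"] x(3,4) that by simp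
    then show "y \<in> {x \<in> carrier M. \<forall>a\<in>carrier A. act x a \<in> N}"
      using y Y(2) by auto
  qed
  then have "N \<subseteq> {x \<in> carrier M. \<forall>a\<in>carrier A. act x a \<in> N}"
    unfolding N_def by (rule right_span_minimal[OF sub[unfolded N_def]])
  then show thesis
    using that[OF Y] \<open>F \<subseteq> N\<close> unfolding N_def by blast
qed


section \<open>Restriction of scalars and rational modules\<close>

context R_ring
begin

lemma right_module_restrict_scalars:
  fixes M :: "('a, 'm, 'u) rmodule_scheme"
  assumes M: "right_module A M"
  shows "right_module R (restrict_scalars A M)"
proof -
  interpret RM: right_module A M by fact
  have "abelian_group (restrict_scalars A M)"
  proof (rule abelian_groupI)
    fix x assume "x \<in> carrier (restrict_scalars A M)"
    then show "\<exists>y\<in>carrier (restrict_scalars A M).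
        y \<oplus>\<^bsub>restrict_scalars A M\<^esub> x = \<zero>\<^bsub>restrict_scalars A M\<^esub>"
      by (intro bexI[of _ "\<ominus>\<^bsub>M\<^esub> x"]) (simp_all add: restrict_scalars_def RM.M.l_neg)
  qed (simp_all add: restrict_scalars_def RM.M.a_ac)
  \<comment> \<open>The unit map is multiplicative: (r1)(s1) = r(1(s1)) = r(s1) = (rs)1.\<close>
  moreover have "(r \<otimes>\<^bsub>R\<^esub> s) \<triangleright>\<^bsub>A\<^esub> \<one>\<^bsub>A\<^esub> = (r \<triangleright>\<^bsub>A\<^esub> \<one>\<^bsub>A\<^esub>) \<otimes>\<^bsub>A\<^esub> (s \<triangleright>\<^bsub>A\<^esub> \<one>\<^bsub>A\<^esub>)"
    if "r \<in> carrier R" "s \<in> carrier R" for r s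
    using that by (simp add: mult_lsmult lsmult_assoc)
  ultimately show ?thesis
    by (intro right_module.intro right_module_axioms.intro R.ring_axioms)
      (simp_all add: restrict_scalars_def RM.rsmult_l_distr RM.rsmult_r_distr RM.rsmult_assoc
        lsmult_l_distr)
qed

lemma restrict_scalars_submodule:
  fixes M :: "('a, 'm, 'u) rmodule_scheme"
  assumes M: "right_module A M" and N: "right_submodule N R (restrict_scalars A M)"
    and closed: "\<And>x a. \<lbrakk>x \<in> N; a \<in> carrier A\<rbrakk> \<Longrightarrow> x \<triangleleft>\<^bsub>M\<^esub> a \<in> N"
  shows "right_submodule N A M"
proof (intro right_submodule.intro right_submodule_axioms.intro)
  interpret RM: right_module A M by fact
  interpret S: right_module R "restrict_scalars A M"
    by (rule right_module_restrict_scalars[OF M])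
  interpret N: right_submodule N R "restrict_scalars A M" by fact
  have NM: "x \<in> carrier M" if "x \<in> N" for x
    using N.subset that by (auto simp: restrict_scalars_def)
  show "subgroup N (add_monoid M)"
  proof (rule RM.M.add.subgroupI)
    fix x assume x: "x \<in> N"
    \<comment> \<open>Closure under negatives is known for the record over R; uniqueness of inverses
      identifies its negative with that of M.\<close>
    let ?y = "\<ominus>\<^bsub>restrict_scalars A M\<^esub> x"
    have "?y \<in> N"
      using N.m_inv_closed[OF x] by (simp add: a_inv_def)
    moreover have "?y \<oplus>\<^bsub>M\<^esub> x = \<zero>\<^bsub>M\<^esub>"
      using S.M.l_neg[of x] NM[OF x] by (simp add: restrict_scalars_def)
    ultimately show "\<ominus>\<^bsub>M\<^esub> x \<in> N"
      using RM.M.minus_equality NM x by metis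
  qed (use NM N.one_closed N.m_closed in \<open>auto simp: restrict_scalars_def\<close>)
qed (rule closed)

end

text \<open>Rationality of N cuts down the carrier before passing to R, while
  \<open>alpha_in_submodule\<close> cuts down a module that is already over R.\<close>

lemma restrict_scalars_carrier_update:
  "restrict_scalars A (M\<lparr>carrier := N\<rparr>) = (restrict_scalars A M)\<lparr>carrier := N\<rparr>"
  by (simp add: restrict_scalars_def)

theorem (in measuring_left_alpha_pairing) rational_module_locally_fin_gen:
  fixes M :: "('a, 'm, 'u) rmodule_scheme"
  assumes rat: "rational_module R A C \<kappa> M" and F: "finite F" "F \<subseteq> carrier M"
  shows "\<exists>N. right_submodule N A M \<and> F \<subseteq> N \<and> rational_module R A C \<kappa> (M\<lparr>carrier := N\<rparr>) \<and>
    right_fin_gen R (restrict_scalars A (M\<lparr>carrier := N\<rparr>))"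
proof -
  let ?S = "restrict_scalars A M"
  have M: "right_module A M"
    and rational: "\<And>x. x \<in> carrier M \<Longrightarrow>
      \<exists>t\<in>carrier (tensor R ?S C). \<forall>a\<in>carrier A. x \<triangleleft>\<^bsub>M\<^esub> a = alpha_map A \<kappa> ?S t a"
    using rat by (auto simp: rational_module_def)
  interpret M: right_module A M by fact
  have S: "right_module R ?S" by (rule A.right_module_restrict_scalars[OF M])
  have [simp]: "carrier ?S = carrier M" by (simp add: restrict_scalars_def)
  obtain Y where Y: "finite Y" "Y \<subseteq> carrier ?S" and FY: "F \<subseteq> right_span R ?S Y"
    and closed: "\<And>x a. \<lbrakk>x \<in> right_span R ?S Y; a \<in> carrier A\<rbrakk> \<Longrightarrow> x \<triangleleft>\<^bsub>M\<^esub> a \<in> right_span R ?S Y"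
  proof (rule rational_action_fin_gen[OF S, of "\<lambda>x a. x \<triangleleft>\<^bsub>M\<^esub> a" F])
    fix x r a assume x: "x \<in> carrier ?S" "r \<in> carrier R" "a \<in> carrier A"
    \<comment> \<open>Over R, xr means x(r1); hence (xr)a = x((r1)a) = x(ra).\<close>
    then have "(x \<triangleleft>\<^bsub>M\<^esub> (r \<triangleright>\<^bsub>A\<^esub> \<one>\<^bsub>A\<^esub>)) \<triangleleft>\<^bsub>M\<^esub> a = x \<triangleleft>\<^bsub>M\<^esub> ((r \<triangleright>\<^bsub>A\<^esub> \<one>\<^bsub>A\<^esub>) \<otimes>\<^bsub>A\<^esub> a)"
      by (simp add: M.rsmult_assoc)
    with x show "(x \<triangleleft>\<^bsub>?S\<^esub> r) \<triangleleft>\<^bsub>M\<^esub> a = x \<triangleleft>\<^bsub>M\<^esub> (r \<triangleright>\<^bsub>A\<^esub> a)"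
      by (simp add: restrict_scalars_def A.mult_lsmult)
  next
    fix x y a assume "x \<in> carrier ?S" "y \<in> carrier ?S" "a \<in> carrier A"
    then show "(x \<oplus>\<^bsub>?S\<^esub> y) \<triangleleft>\<^bsub>M\<^esub> a = x \<triangleleft>\<^bsub>M\<^esub> a \<oplus>\<^bsub>?S\<^esub> y \<triangleleft>\<^bsub>M\<^esub> a"
      by (simp add: restrict_scalars_def M.rsmult_l_distr)
  qed (use rational F in \<open>simp_all add: M.rsmult_assoc\<close>)
  define N where "N = right_span R ?S Y"
  have N: "right_submodule N R ?S"
    unfolding N_def by (rule right_submodule_right_span[OF S Y(2)])
  have NA: "right_submodule N A M"
    by (rule A.restrict_scalars_submodule[OF M N]) (simp add: N_def closed)
  let ?SN = "?S\<lparr>carrier := N\<rparr>"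
  have SN: "right_module R ?SN" by (rule right_module_submodule[OF S N])
  have "\<exists>s\<in>carrier (tensor R ?SN C). \<forall>a\<in>carrier A. x \<triangleleft>\<^bsub>M\<^esub> a = alpha_map A \<kappa> ?SN s a"
    if x: "x \<in> N" for x
  proof -
    have "x \<in> carrier M"
      using right_module.submodule_in_carrier[OF S N x] by simp
    then obtain t where t: "t \<in> carrier (tensor R ?S C)"
        "\<forall>a\<in>carrier A. x \<triangleleft>\<^bsub>M\<^esub> a = alpha_map A \<kappa> ?S t a"
      using rational by blast
    have "alpha_map A \<kappa> ?S t a \<in> N" if "a \<in> carrier A" for a
      using t(2) closed[OF x[unfolded N_def] that] that by (simp add: N_def)
    then obtain s where s: "s \<in> carrier (tensor R ?SN C)"
        "t = tensor_map R ?S C (\<lambda>x. x) (\<lambda>c. c) s"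
      using alpha_in_submodule[OF S N t(1)] by blast
    have "x \<triangleleft>\<^bsub>M\<^esub> a = alpha_map A \<kappa> ?SN s a" if "a \<in> carrier A" for a
      using alpha_map_natural[OF SN S linear_map_inclusion[OF N] that s(1)] t(2) that s(2) by simp
    with s(1) show ?thesis by blast
  qed
  then have "rational_module R A C \<kappa> (M\<lparr>carrier := N\<rparr>)"
    using right_module_submodule[OF M NA]
    by (simp add: rational_module_def restrict_scalars_carrier_update)
  moreover have "right_fin_gen R (restrict_scalars A (M\<lparr>carrier := N\<rparr>))"
    unfolding restrict_scalars_carrier_update N_def by (rule right_fin_gen_right_span[OF S Y])
  ultimately show ?thesis
    using NA FY unfolding N_def by blast
qed

subsection \<open>The action on the coring\<close>

lemma balanced_map_cong:
  assumes M: "right_module R M" and N: "left_module R N" and \<beta>: "balanced_map R M N G \<beta>"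
    and eq: "\<And>x y. \<lbrakk>x \<in> carrier M; y \<in> carrier N\<rbrakk> \<Longrightarrow> \<beta>' x y = \<beta> x y"
  shows "balanced_map R M N G \<beta>'"
proof -
  interpret M: right_module R M by fact
  interpret N: left_module R N by fact
  show ?thesis
    using \<beta> by (simp add: balanced_map_def eq)
qed

text \<open>Needed where integrands agree only on the carriers: \<kappa> of the unit is the counit
  restricted to C, and the two may differ as HOL functions.\<close>

lemma tensor_lift_cong:
  assumes M: "right_module R M" and N: "left_module R N" and G: "comm_group G"
    and \<beta>: "balanced_map R M N G \<beta>"
    and eq: "\<And>x y. \<lbrakk>x \<in> carrier M; y \<in> carrier N\<rbrakk> \<Longrightarrow> \<beta>' x y = \<beta> x y"
    and t: "t \<in> carrier (tensor R M N)"
  shows "tensor_lift G \<beta>' t = tensor_lift G \<beta> t"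
proof -
  have \<beta>': "balanced_map R M N G \<beta>'"
    by (rule balanced_map_cong[OF M N \<beta> eq])
  show ?thesis
    by (rule tensor_hom_eqI[OF M N comm_group.axioms(2)[OF G] tensor_lift_hom[OF M N G \<beta>']
        tensor_lift_hom[OF M N G \<beta>] _ t])
      (simp add: tensor_lift_pure[OF M N G \<beta>] tensor_lift_pure[OF M N G \<beta>'] eq)
qed

text \<open>A lift in two stages. For fixed z the inner integrand is balanced in x and y, so
  \<open>B s z\<close> is additive in s; the laws involving z then reduce to pure s. In
  \<open>tensor_assoc_pure\<close> the first factor s stays arbitrary, because it will be
  \<Delta>(x), which is not pure in general.\<close>

lemma tensor_assoc:
  assumes L: "bimodule R L" and M: "bimodule R M" and N: "bimodule R N"
  defines "T \<equiv> tensor R L (tensor_bimodule R M N)"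
    and "B \<equiv> \<lambda>s z. tensor_lift (tensor R L (tensor_bimodule R M N))
      (\<lambda>x y. pure_tensor R L (tensor_bimodule R M N) x (pure_tensor R M N y z)) s"
  shows tensor_assoc_hom:
      "tensor_assoc R L M N \<in> hom (tensor R (tensor_bimodule R L M) N) T"
    and tensor_assoc_pure: "\<And>s z. \<lbrakk>s \<in> carrier (tensor R L M); z \<in> carrier N\<rbrakk> \<Longrightarrow>
      tensor_assoc R L M N (pure_tensor R (tensor_bimodule R L M) N s z) = B s z"
    and balanced_tensor_assoc: "\<And>z. z \<in> carrier N \<Longrightarrow>
      balanced_map R L M T (\<lambda>x y. pure_tensor R L (tensor_bimodule R M N) x (pure_tensor R M N y z))"
proof -
  interpret L: bimodule R L by fact
  interpret M: bimodule R M by fact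
  interpret N: bimodule R N by fact
  let ?MN = "tensor_bimodule R M N"
  let ?LM = "tensor_bimodule R L M"
  interpret MN: bimodule R ?MN by (rule bimodule_tensor_bimodule[OF M N])
  interpret LM: bimodule R ?LM by (rule bimodule_tensor_bimodule[OF L M])
  note l = L.right_module_axioms M.left_module_axioms
  note o = L.right_module_axioms MN.left_module_axioms
  note m = M.right_module_axioms N.left_module_axioms
  have Tc: "comm_group T" unfolding T_def by (rule tensor_comm_group[OF o])
  interpret T: comm_group T by (rule Tc)
  let ?\<beta> = "\<lambda>z x y. pure_tensor R L ?MN x (pure_tensor R M N y z)"
  note b1 = balanced_pure_tensor[OF o, folded T_def, unfolded balanced_map_def]
  note b2 = balanced_pure_tensor[OF m, unfolded balanced_map_def]
  have \<beta>: "balanced_map R L M T (?\<beta> z)" if "z \<in> carrier N" for z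
    using b1 b2 that
    by (simp add: balanced_map_def tensor_bimodule_smult_pure[OF M N, symmetric])
  show "balanced_map R L M T (?\<beta> z)" if "z \<in> carrier N" for z
    by (rule \<beta>[OF that])
  have B: "B s z = tensor_lift T (?\<beta> z) s" for s z
    by (simp add: B_def T_def)
  have Bh: "(\<lambda>s. B s z) \<in> hom (tensor R L M) T" if "z \<in> carrier N" for z
    unfolding B by (rule tensor_lift_hom[OF l Tc \<beta>[OF that]])
  have Bp: "B (pure_tensor R L M x y) z = ?\<beta> z x y"
    if "x \<in> carrier L" "y \<in> carrier M" "z \<in> carrier N" for x y z
    unfolding B using that by (intro tensor_lift_pure[OF l Tc \<beta>])
  have add: "B s (z \<oplus>\<^bsub>N\<^esub> z') = B s z \<otimes>\<^bsub>T\<^esub> B s z'"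
    if "s \<in> carrier (tensor R L M)" "z \<in> carrier N" "z' \<in> carrier N" for s z z'
    by (rule tensor_hom_eqI[OF l T.is_group Bh hom_mult_pointwise[OF Tc Bh Bh] _ that(1)])
      (use that b1 b2 in \<open>simp_all add: Bp\<close>)
  have smult: "B (s \<triangleleft>\<^bsub>?LM\<^esub> r) z = B s (r \<triangleright>\<^bsub>N\<^esub> z)"
    if "s \<in> carrier (tensor R L M)" "r \<in> carrier R" "z \<in> carrier N" for s r z
    by (rule tensor_hom_eqI[OF l T.is_group
          hom_compose[OF tensor_bimodule_smult_hom(1)[OF L M that(2)] Bh, unfolded comp_def]
          Bh _ that(1)])
      (use that b2 in \<open>simp_all add: Bp tensor_bimodule_smult_pure[OF L M]\<close>)
  have Bb: "balanced_map R ?LM N T B"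
    unfolding balanced_map_def
    using hom_in_carrier[OF Bh] hom_mult[OF Bh] add smult by simp
  have assoc: "tensor_assoc R L M N = tensor_lift T B"
    by (simp add: tensor_assoc_def Let_def B_def T_def)
  note n = LM.right_module_axioms N.left_module_axioms
  show "tensor_assoc R L M N \<in> hom (tensor R ?LM N) T"
    unfolding assoc by (rule tensor_lift_hom[OF n Tc Bb])
  show "tensor_assoc R L M N (pure_tensor R ?LM N s z) = B s z"
    if "s \<in> carrier (tensor R L M)" "z \<in> carrier N" for s z
    unfolding assoc by (rule tensor_lift_pure[OF n Tc Bb]) (use that in simp_all)
qed

section \<open>The A-module laws on C\<close>

context measuring_left_pairing
begin

lemma comult_closed: "c \<in> carrier C \<Longrightarrow> comult C c \<in> carrier (tensor R C C)"
  and comult_add: "\<lbrakk>c \<in> carrier C; d \<in> carrier C\<rbrakk> \<Longrightarrow>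
    comult C (c \<oplus>\<^bsub>C\<^esub> d) = comult C c \<otimes>\<^bsub>tensor R C C\<^esub> comult C d"
  and comult_lsmult: "\<lbrakk>r \<in> carrier R; c \<in> carrier C\<rbrakk> \<Longrightarrow>
    comult C (r \<triangleright>\<^bsub>C\<^esub> c) = r \<triangleright>\<^bsub>tensor_bimodule R C C\<^esub> comult C c"
  and comult_rsmult: "\<lbrakk>r \<in> carrier R; c \<in> carrier C\<rbrakk> \<Longrightarrow>
    comult C (c \<triangleleft>\<^bsub>C\<^esub> r) = comult C c \<triangleleft>\<^bsub>tensor_bimodule R C C\<^esub> r"
  using C.comult_hom by (auto simp: bimodule_hom_def)

text \<open>The right action of A on C, written as a bare function for use as \<open>act\<close>.
  Rationality holds by construction, with \<Delta>(c) as the tensor representing c.\<close>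

definition coaction :: "'c \<Rightarrow> 'a \<Rightarrow> 'c"
  where "coaction c = alpha_map A \<kappa> C (comult C c)"

text \<open>The scalar acts on the second leg, and \<langle>a, cr\<rangle> = \<langle>ra, c\<rangle>
  by the left scalars of the dual.\<close>

lemma alpha_map_tensor_rsmult:
  assumes t: "t \<in> carrier (tensor R C C)" and r: "r \<in> carrier R" and a: "a \<in> carrier A"
  shows "alpha_map A \<kappa> C (t \<triangleleft>\<^bsub>tensor_bimodule R C C\<^esub> r) a = alpha_map A \<kappa> C t (r \<triangleright>\<^bsub>A\<^esub> a)"
proof -
  note C = C.right_module_axioms
  have ra: "r \<triangleright>\<^bsub>A\<^esub> a \<in> carrier A" using r a by simp
  show ?thesis
    by (rule tensor_hom_eqI[OF C C.left_module_axioms C.M.a_group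
          hom_compose[OF tensor_bimodule_smult_hom(1)[OF C.bimodule_axioms C.bimodule_axioms r]
            alpha_map_hom[OF C a], unfolded comp_def]
          alpha_map_hom[OF C ra] _ t])
      (use r a in \<open>simp add: tensor_bimodule_smult_pure[OF C.bimodule_axioms C.bimodule_axioms]
          alpha_map_pure[OF C] kappa_lsmult\<close>)
qed

lemma coaction_add:
  assumes "c \<in> carrier C" "d \<in> carrier C" "a \<in> carrier A"
  shows "coaction (c \<oplus>\<^bsub>C\<^esub> d) a = coaction c a \<oplus>\<^bsub>C\<^esub> coaction d a"
  using hom_mult[OF alpha_map_hom[OF C.right_module_axioms assms(3)]] assms
  by (simp add: coaction_def comult_add comult_closed)

lemma coaction_rsmult:
  assumes "c \<in> carrier C" "r \<in> carrier R" "a \<in> carrier A"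
  shows "coaction (c \<triangleleft>\<^bsub>C\<^esub> r) a = coaction c (r \<triangleright>\<^bsub>A\<^esub> a)"
  using assms by (simp add: coaction_def comult_rsmult comult_closed alpha_map_tensor_rsmult)

text \<open>\<kappa> preserves unities, so pairing with the unit is the counit and the right counit
  law applies.\<close>

lemma coaction_one:
  assumes c: "c \<in> carrier C"
  shows "coaction c \<one>\<^bsub>A\<^esub> = c"
proof -
  note C = C.right_module_axioms
  have "coaction c \<one>\<^bsub>A\<^esub> = tensor_lift (add_monoid C) (\<lambda>c1 c2. c1 \<triangleleft>\<^bsub>C\<^esub> \<kappa> \<one>\<^bsub>A\<^esub> c2) (comult C c)"
    by (simp add: coaction_def alpha_map_def)
  also have "\<dots> = tensor_lift (add_monoid C) (\<lambda>c1 c2. c1 \<triangleleft>\<^bsub>C\<^esub> counit C c2) (comult C c)"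
    by (rule tensor_lift_cong[OF C C.left_module_axioms C.M.a_comm_group
          balanced_alpha[OF C, of "\<one>\<^bsub>A\<^esub>"] _ comult_closed[OF c], symmetric])
      (simp_all add: kappa_one)
  also have "\<dots> = c" by (rule C.counit_r[OF c])
  finally show ?thesis .
qed

text \<open>
  The two sides of coassociativity, mapped to \<open>C\<close> by \<open>x \<otimes> y \<otimes> z \<mapsto> x \<langle>b, y \<langle>a, z\<rangle>\<rangle>\<close>.
\<close>

lemma coaction_mult:
  assumes c: "c \<in> carrier C" and a: "a \<in> carrier A" and b: "b \<in> carrier A"
  shows "coaction c (a \<otimes>\<^bsub>A\<^esub> b) = coaction (coaction c a) b"
proof -
  let ?CC = "tensor_bimodule R C C"
  note C = C.right_module_axioms and C' = C.left_module_axioms and CB = C.bimodule_axioms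
  note Cg = C.M.a_comm_group
  interpret CC: bimodule R ?CC by (rule bimodule_tensor_bimodule[OF CB CB])
  note CC = CC.right_module_axioms and CC' = CC.left_module_axioms
  have ab: "a \<otimes>\<^bsub>A\<^esub> b \<in> carrier A" using a b by simp
  let ?\<beta> = "\<lambda>c1 c2. \<kappa> b (c1 \<triangleleft>\<^bsub>C\<^esub> \<kappa> a c2)"
  have Rg: "comm_group (add_monoid R)" by (rule abelian_group.a_comm_group[OF ring.is_abelian_group[OF A.R.ring_axioms]])
  have \<beta>: "balanced_map R C C (add_monoid R) ?\<beta>"
    using a b
    by (simp add: balanced_map_def kappa_closed kappa_linear C.rsmult_l_distr C.rsmult_r_distr C.rsmult_assoc)
  \<comment> \<open>Sends y \<otimes> z to \<langle>b, y\<langle>a, z\<rangle>\<rangle>. By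
    \<open>kappa_mult\<close> its value at \<Delta>(d) is \<langle>ab, d\<rangle>: it encodes the
    product of the left dual.\<close>
  define \<psi> where "\<psi> = tensor_lift (add_monoid R) ?\<beta>"
  have \<psi>h: "\<psi> \<in> hom (tensor R C C) (add_monoid R)"
    unfolding \<psi>_def by (rule tensor_lift_hom[OF C C' Rg \<beta>])
  have \<psi>p: "\<psi> (pure_tensor R C C x y) = ?\<beta> x y" if "x \<in> carrier C" "y \<in> carrier C" for x y
    unfolding \<psi>_def by (rule tensor_lift_pure[OF C C' Rg \<beta> that])
  have \<psi>c: "\<psi> w \<in> carrier R" if "w \<in> carrier (tensor R C C)" for w
    using hom_in_carrier[OF \<psi>h that] by simp
  \<comment> \<open>This lets a scalar cross from x into the inner tensor w, which makes the map
    sending x, w to x \<psi>(w) balanced.\<close>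
  have \<psi>l: "\<psi> (r \<triangleright>\<^bsub>?CC\<^esub> w) = r \<otimes>\<^bsub>R\<^esub> \<psi> w" if r: "r \<in> carrier R" and w: "w \<in> carrier (tensor R C C)" for r w
  proof -
    have rh: "(\<lambda>x. r \<otimes>\<^bsub>R\<^esub> x) \<in> hom (add_monoid R) (add_monoid R)"
      using r by (auto simp: hom_def A.R.r_distr)
    show ?thesis
      by (rule tensor_hom_eqI[OF C C' comm_group.axioms(2)[OF Rg]
            hom_compose[OF tensor_bimodule_smult_hom(2)[OF CB CB r] \<psi>h, unfolded comp_def]
            hom_compose[OF \<psi>h rh, unfolded comp_def] _ w])
        (use r a b in \<open>simp add: tensor_bimodule_smult_pure[OF CB CB] \<psi>p C.lsmult_rsmult
            kappa_linear kappa_closed\<close>)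
  qed
  let ?\<gamma> = "\<lambda>x w. x \<triangleleft>\<^bsub>C\<^esub> \<psi> w"
  have \<gamma>: "balanced_map R C ?CC (add_monoid C) ?\<gamma>"
    using hom_mult[OF \<psi>h]
    by (simp add: balanced_map_def \<psi>c \<psi>l C.rsmult_l_distr C.rsmult_r_distr C.rsmult_assoc)
  define \<Phi> where "\<Phi> = tensor_lift (add_monoid C) ?\<gamma>"
  let ?T = "tensor R C ?CC"
  have \<Phi>h: "\<Phi> \<in> hom ?T (add_monoid C)"
    unfolding \<Phi>_def by (rule tensor_lift_hom[OF C CC' Cg \<gamma>])
  have \<Phi>p: "\<Phi> (pure_tensor R C ?CC x w) = ?\<gamma> x w"
    if "x \<in> carrier C" "w \<in> carrier (tensor R C C)" for x w
    unfolding \<Phi>_def using that by (intro tensor_lift_pure[OF C CC' Cg \<gamma>]) simp_all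
  have comult_left: "left_linear_map R C ?CC (comult C)"
    by (simp add: left_linear_map_def comult_closed comult_add comult_lsmult)
  have comult_right: "linear_map R C ?CC (comult C)"
    by (simp add: linear_map_def comult_closed comult_add comult_rsmult)
  note m1 = tensor_map_hom[OF C C' C CC' linear_map_id comult_left]
    and p1 = tensor_map_pure[OF C C' C CC' linear_map_id comult_left]
  note m2 = tensor_map_hom[OF C C' CC C' comult_right left_linear_map_id]
    and p2 = tensor_map_pure[OF C C' CC C' comult_right left_linear_map_id]
  \<comment> \<open>On x \<otimes> d the left side is x \<psi>(\<Delta>(d)) = x \<langle>ab,
    d\<rangle>.\<close>
  have 1: "\<Phi> (tensor_map R C ?CC (\<lambda>d. d) (comult C) t) = alpha_map A \<kappa> C t (a \<otimes>\<^bsub>A\<^esub> b)"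
    if t: "t \<in> carrier (tensor R C C)" for t
    by (rule tensor_hom_eqI[OF C C' C.M.a_group hom_compose[OF m1 \<Phi>h, unfolded comp_def]
          alpha_map_hom[OF C ab] _ t])
      (use a b in \<open>simp add: p1 \<Phi>p comult_closed alpha_map_pure[OF C] kappa_mult \<psi>_def\<close>)
  let ?B = "\<lambda>z. tensor_lift ?T (\<lambda>x y. pure_tensor R C ?CC x (pure_tensor R C C y z))"
  note bh = tensor_lift_hom[OF C C' tensor_comm_group[OF C CC'] balanced_tensor_assoc[OF CB CB CB]]
    and bp = tensor_lift_pure[OF C C' tensor_comm_group[OF C CC'] balanced_tensor_assoc[OF CB CB CB]]
  \<comment> \<open>For w = x \<otimes> y both sides are x \<langle>b, y\<langle>a,
    z\<rangle>\<rangle>.\<close>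
  have 2: "\<Phi> (?B z w) = alpha_map A \<kappa> C (w \<triangleleft>\<^bsub>?CC\<^esub> \<kappa> a z) b"
    if w: "w \<in> carrier (tensor R C C)" and z: "z \<in> carrier C" for w z
    by (rule tensor_hom_eqI[OF C C' C.M.a_group hom_compose[OF bh[OF z] \<Phi>h, unfolded comp_def]
          hom_compose[OF tensor_bimodule_smult_hom(1)[OF CB CB kappa_closed[OF a z]]
            alpha_map_hom[OF C b], unfolded comp_def] _ w])
      (use a b z in \<open>simp add: bp \<Phi>p \<psi>p pure_tensor_closed kappa_closed
          tensor_bimodule_smult_pure[OF CB CB] alpha_map_pure[OF C]\<close>)
  have act_hom: "(\<lambda>x. coaction x b) \<in> hom (add_monoid C) (add_monoid C)"
  proof (rule homI)
    show "coaction x b \<in> carrier (add_monoid C)" if "x \<in> carrier (add_monoid C)" for x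
      using that b alpha_map_closed[OF C] by (simp add: coaction_def comult_closed)
  qed (simp add: coaction_add b)
  \<comment> \<open>On x \<otimes> z, step 2 is used with w = \<Delta>(x). Right linearity of
    \<Delta> turns w\<langle>a, z\<rangle> into \<Delta>(x\<langle>a, z\<rangle>), whose
    \<alpha>-value at b is the action of b on x\<langle>a, z\<rangle>.\<close>
  have 3: "\<Phi> (tensor_assoc R C C C (tensor_map R ?CC C (comult C) (\<lambda>d. d) t)) =
      coaction (alpha_map A \<kappa> C t a) b"
    if t: "t \<in> carrier (tensor R C C)" for t
    by (rule tensor_hom_eqI[OF C C' C.M.a_group
          hom_compose[OF hom_compose[OF m2 tensor_assoc_hom[OF CB CB CB]] \<Phi>h, unfolded comp_def]
          hom_compose[OF alpha_map_hom[OF C a] act_hom, unfolded comp_def] _ t])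
      (use a b in \<open>simp add: p2 tensor_assoc_pure[OF CB CB CB] comult_closed 2 alpha_map_pure[OF C]
          coaction_def comult_rsmult kappa_closed\<close>)
  show ?thesis
    using C.coassoc[OF c] 1[OF comult_closed[OF c]] 3[OF comult_closed[OF c]]
    by (simp add: coaction_def)
qed

end

theorem (in measuring_left_alpha_pairing) coideal_locally_fin_gen:
  assumes F: "finite F" "F \<subseteq> carrier C"
  shows "\<exists>K. right_coideal R C K \<and> F \<subseteq> K \<and> right_fin_gen R (C\<lparr>carrier := K\<rparr>)"
proof -
  note C = C.right_module_axioms
  obtain Y where Y: "finite Y" "Y \<subseteq> carrier C" and FY: "F \<subseteq> right_span R C Y"
    and closed: "\<And>x a. \<lbrakk>x \<in> right_span R C Y; a \<in> carrier A\<rbrakk> \<Longrightarrow> coaction x a \<in> right_span R C Y"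
  proof (rule rational_action_fin_gen[OF C, of coaction F])
    fix x assume "x \<in> carrier C"
    then show "\<exists>t\<in>carrier (tensor R C C). \<forall>a\<in>carrier A. coaction x a = alpha_map A \<kappa> C t a"
      unfolding coaction_def using comult_closed by blast
  qed (use F in \<open>simp_all add: coaction_add coaction_rsmult coaction_one coaction_mult\<close>)
  define K where "K = right_span R C Y"
  have K: "right_submodule K R C"
    unfolding K_def by (rule right_submodule_right_span[OF C Y(2)])
  have "comult C x \<in> tensor_map R C C (\<lambda>x. x) (\<lambda>y. y) ` carrier (tensor R (C\<lparr>carrier := K\<rparr>) C)"
    if x: "x \<in> K" for x
    using closed x comult_closed[OF C.submodule_in_carrier[OF K x]]
    by (intro alpha_in_submodule[OF C K]) (simp_all add: K_def coaction_def)
  then have "right_coideal R C K"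
    using K by (auto simp: right_coideal_def)
  moreover have "right_fin_gen R (C\<lparr>carrier := K\<rparr>)"
    unfolding K_def by (rule right_fin_gen_right_span[OF C Y])
  ultimately show ?thesis
    using FY unfolding K_def by blast
qed

theorem mainTheorem3:
  fixes R :: "('r, 'z) ring_scheme"
    and A :: "('r, 'a, 'v) bimodule_scheme"
    and C :: "('r, 'c, 'w) coring_scheme"
    and \<kappa> :: "'a \<Rightarrow> 'c \<Rightarrow> 'r"
  assumes "ring R" and "\<one>\<^bsub>R\<^esub> \<noteq> \<zero>\<^bsub>R\<^esub>"
    and "measuring_left_alpha_pairing R A C \<kappa>"
  shows "(\<forall>M :: ('a, 'm) rmodule. rational_module R A C \<kappa> M \<longrightarrow>
           (\<forall>F. finite F \<and> F \<subseteq> carrier M \<longrightarrow>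
             (\<exists>N. right_submodule N A M \<and> F \<subseteq> N \<and>
                  rational_module R A C \<kappa> (M\<lparr>carrier := N\<rparr>) \<and>
                  right_fin_gen R (restrict_scalars A (M\<lparr>carrier := N\<rparr>)))))
       \<and> (\<forall>F. finite F \<and> F \<subseteq> carrier C \<longrightarrow>
             (\<exists>K. right_coideal R C K \<and> F \<subseteq> K \<and>
                  right_fin_gen R (C\<lparr>carrier := K\<rparr>)))"
proof -
  interpret measuring_left_alpha_pairing R A C \<kappa> by (rule assms(3))
  show ?thesis
    by (intro conjI allI impI; elim conjE)
      (rule rational_module_locally_fin_gen coideal_locally_fin_gen; assumption)+
qed

end
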